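(* Let $G$ be a connected minimally rigid graph (in $\mathbb{R}^2$) of order $n\geq 3$. Then $\rho(G)\leq \rho(K_2\nabla (n-2)K_{1})$, with equality if and only if $G\cong K_2\nabla (n-2)K_{1}$.
   Context: For a graph $G$, $\rho(G)$ denotes the spectral radius, i.e. the largest eigenvalue of its adjacency matrix. $K_2\nabla (n-2)K_1$ denotes the join of an edge $K_2$ with $n-2$ isolated vertices (every vertex of $K_2$ is joined to each of the $n-2$ other vertices). A $2$-dimensional framework $(G,p)$ is a graph $G=(V,E)$ with a map $p:V\to\mathbb{R}^2$; $(G,p)$ and $(G,q)$ are equivalent if $\|p(u)-p(v)\|=\|q(u)-q(v)\|$ for every edge $uv\in E$, and congruent if this holds for all $u,v\in V$; a framework is generic if the coordinates of its points are algebraically independent over $\mathbb{Q}$. A graph $G$ is rigid in $\mathbb{R}^2$ if for every generic framework $(G,p)$ there is $\varepsilon>0$ such that every framework $(G,q)$ equivalent to $(G,p)$ with $\|p(u)-q(u)\|<\varepsilon$ for all $u$ is congruent to $(G,p)$. A graph $G$ is minimally rigid if $G$ is rigid in $\mathbb{R}^2$ and $G-e$ is not rigid in $\mathbb{R}^2$ for every edge $e\in E(G)$. *)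

theory Defs
  imports
    "HOL-Analysis.Cartesian_Euclidean_Space"
    "HOL-Library.Poly_Mapping"
    "Graph_Theory.Graph_Theory"
    "Jordan_Normal_Form.Spectral_Radius"
begin

text \<open>
  A finite simple graph is a \<^locale>\<open>pair_graph\<close>: an edge \<open>uv\<close> is represented by the
  two pairs \<open>(u, v)\<close> and \<open>(v, u)\<close> in \<^const>\<open>parcs\<close>.
\<close>

definition adjacency_matrix :: "'a list \<Rightarrow> 'a pair_pre_digraph \<Rightarrow> real Matrix.mat" where
  "adjacency_matrix vs G =
     Matrix.mat (length vs) (length vs) (\<lambda>(i, j). if (vs ! i, vs ! j) \<in> parcs G then 1 else 0)"

definition vertex_order :: "'a pair_pre_digraph \<Rightarrow> 'a list" where
  "vertex_order G = (SOME vs. distinct vs \<and> set vs = pverts G)"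

text \<open>
  The adjacency matrix is real symmetric, so \<^const>\<open>Max\<close> is taken over a finite nonempty set
  as soon as the graph has a vertex.  The chosen vertex order is immaterial, see
  \<open>graph_spectral_radius_eq\<close> below.
\<close>

definition graph_spectral_radius :: "'a pair_pre_digraph \<Rightarrow> real" where
  "graph_spectral_radius G = Max (spectrum (adjacency_matrix (vertex_order G) G))"

lemma vertex_order:
  assumes "finite (pverts G)"
  shows "distinct (vertex_order G)" "set (vertex_order G) = pverts G"
proof -
  obtain vs where "distinct vs \<and> set vs = pverts G"
    using finite_distinct_list[OF assms] by blast
  then have "distinct (vertex_order G) \<and> set (vertex_order G) = pverts G"
    unfolding vertex_order_def by (rule someI)
  then show "distinct (vertex_order G)" "set (vertex_order G) = pverts G" by auto
qed

lemma eigenvalue_adjacency_matrix_iff: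
  assumes d: "distinct vs" and s: "set vs = pverts G"
  shows "eigenvalue (adjacency_matrix vs G) k \<longleftrightarrow>
    (\<exists>f. (\<exists>v\<in>pverts G. f v \<noteq> 0) \<and>
         (\<forall>u\<in>pverts G. (\<Sum>v\<in>pverts G. if (u, v) \<in> parcs G then f v else 0) = k * f u))"
proof -
  let ?n = "length vs" and ?A = "adjacency_matrix vs G"
  have bij: "bij_betw ((!) vs) {0..<?n} (pverts G)"
    using bij_betw_nth[OF d, of "{0..<?n}" "pverts G"] s by (auto simp: lessThan_atLeast0)
  have A: "dim_row ?A = ?n" "dim_col ?A = ?n" by (auto simp: adjacency_matrix_def)
  have mul: "vec_index (?A *\<^sub>v w) i =
      (\<Sum>v\<in>pverts G. if (vs ! i, v) \<in> parcs G then f v else 0)"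
    if w: "w \<in> carrier_vec ?n" and f: "\<And>i. i < ?n \<Longrightarrow> vec_index w i = f (vs ! i)"
      and i: "i < ?n" for w f i
  proof -
    have "vec_index (?A *\<^sub>v w) i =
        (\<Sum>j\<in>{0..<?n}. (if (vs ! i, vs ! j) \<in> parcs G then 1 else 0) * vec_index w j)"
      using w i by (simp add: adjacency_matrix_def scalar_prod_def)
    also have "\<dots> = (\<Sum>j\<in>{0..<?n}. if (vs ! i, vs ! j) \<in> parcs G then f (vs ! j) else 0)"
      by (rule sum.cong) (auto simp: f)
    also have "\<dots> = (\<Sum>v\<in>pverts G. if (vs ! i, v) \<in> parcs G then f v else 0)"
      by (rule sum.reindex_bij_betw[OF bij])
    finally show ?thesis .
  qed
  show ?thesis
  proof
    assume "eigenvalue ?A k"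
    then obtain w where w: "w \<in> carrier_vec ?n" "w \<noteq> 0\<^sub>v ?n" "?A *\<^sub>v w = k \<cdot>\<^sub>v w"
      by (auto simp: eigenvalue_def eigenvector_def A)
    define f where "f v = vec_index w (the_inv_into {0..<?n} ((!) vs) v)" for v
    have f: "vec_index w i = f (vs ! i)" if "i < ?n" for i
      using that bij the_inv_into_f_f[of "(!) vs" "{0..<?n}" i] by (simp add: f_def bij_betw_def)
    obtain i where i: "i < ?n" "vec_index w i \<noteq> 0"
      using w(1,2) by (metis carrier_vecD eq_vecI index_zero_vec(1) index_zero_vec(2))
    have "\<exists>v\<in>pverts G. f v \<noteq> 0" using i f s by (metis nth_mem)
    moreover have "(\<Sum>v\<in>pverts G. if (u, v) \<in> parcs G then f v else 0) = k * f u"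
      if "u \<in> pverts G" for u
    proof -
      obtain j where j: "j < ?n" "u = vs ! j" using \<open>u \<in> pverts G\<close> s by (metis in_set_conv_nth)
      show ?thesis using mul[OF w(1) f j(1)] j w f[OF j(1)] by simp
    qed
    ultimately show "\<exists>f. (\<exists>v\<in>pverts G. f v \<noteq> 0) \<and>
         (\<forall>u\<in>pverts G. (\<Sum>v\<in>pverts G. if (u, v) \<in> parcs G then f v else 0) = k * f u)"
      by blast
  next
    assume "\<exists>f. (\<exists>v\<in>pverts G. f v \<noteq> 0) \<and>
         (\<forall>u\<in>pverts G. (\<Sum>v\<in>pverts G. if (u, v) \<in> parcs G then f v else 0) = k * f u)"
    then obtain f v where v: "v \<in> pverts G" "f v \<noteq> 0"
      and ev: "\<And>u. u \<in> pverts G \<Longrightarrow>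
        (\<Sum>v\<in>pverts G. if (u, v) \<in> parcs G then f v else 0) = k * f u" by blast
    define w where "w = Matrix.vec ?n (\<lambda>i. f (vs ! i))"
    have w: "w \<in> carrier_vec ?n" by (simp add: w_def)
    have f: "\<And>i. i < ?n \<Longrightarrow> vec_index w i = f (vs ! i)" by (simp add: w_def)
    obtain i where i: "i < ?n" "v = vs ! i" using v(1) s by (metis in_set_conv_nth)
    have "w \<noteq> 0\<^sub>v ?n" using f[OF i(1)] i v(2) by auto
    moreover have "?A *\<^sub>v w = k \<cdot>\<^sub>v w"
    proof (rule eq_vecI)
      fix j assume "j < dim_vec (k \<cdot>\<^sub>v w)"
      then have j: "j < ?n" using w by simp
      then have "vs ! j \<in> pverts G" using s nth_mem by blast
      then show "vec_index (?A *\<^sub>v w) j = vec_index (k \<cdot>\<^sub>v w) j"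
        using mul[OF w f j] ev f[OF j] w j by simp
    qed (use w A in auto)
    ultimately show "eigenvalue ?A k"
      using w by (auto simp: eigenvalue_def eigenvector_def A)
  qed
qed

lemma graph_spectral_radius_eq:
  assumes "distinct vs" "set vs = pverts G"
  shows "graph_spectral_radius G = Max (spectrum (adjacency_matrix vs G))"
proof -
  have "finite (pverts G)" using assms(2) by (metis List.finite_set)
  have "eigenvalue (adjacency_matrix (vertex_order G) G) k \<longleftrightarrow> eigenvalue (adjacency_matrix vs G) k"
    for k
    by (simp only: eigenvalue_adjacency_matrix_iff[OF assms]
      eigenvalue_adjacency_matrix_iff[OF vertex_order[OF \<open>finite (pverts G)\<close>]])
  then show ?thesis
    unfolding graph_spectral_radius_def spectrum_def by presburger
qed

definition complete_graph :: "nat \<Rightarrow> nat pair_pre_digraph" where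
  "complete_graph m = \<lparr>pverts = {..<m}, parcs = {(u, v). u < m \<and> v < m \<and> u \<noteq> v}\<rparr>"

definition edgeless_graph :: "nat \<Rightarrow> nat pair_pre_digraph" where
  "edgeless_graph m = \<lparr>pverts = {..<m}, parcs = {}\<rparr>"

definition graph_join ::
  "'a pair_pre_digraph \<Rightarrow> 'b pair_pre_digraph \<Rightarrow> ('a + 'b) pair_pre_digraph" where
  "graph_join G H =
     \<lparr>pverts = Inl ` pverts G \<union> Inr ` pverts H,
      parcs = map_prod Inl Inl ` parcs G \<union> map_prod Inr Inr ` parcs H
        \<union> (Inl ` pverts G) \<times> (Inr ` pverts H) \<union> (Inr ` pverts H) \<times> (Inl ` pverts G)\<rparr>"

definition K2_join_isolated :: "nat \<Rightarrow> (nat + nat) pair_pre_digraph" where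
  "K2_join_isolated n = graph_join (complete_graph 2) (edgeless_graph (n - 2))"

lemma pair_graph_K2_join_isolated: "pair_graph (K2_join_isolated n)"
  by unfold_locales
    (auto simp: K2_join_isolated_def graph_join_def complete_graph_def edgeless_graph_def
      symmetric_def sym_def intro: finite_subset[of _ "{..<2} \<times> {..<2}"])

text \<open>
  \<^typ>\<open>('i \<Rightarrow>\<^sub>0 nat) \<Rightarrow>\<^sub>0 rat\<close> is the polynomial ring over the rationals with variables
  indexed by \<^typ>\<open>'i\<close>: the outer map assigns coefficients to monomials, the inner one
  exponents to variables.
\<close>

definition rat_poly_eval :: "(('i \<Rightarrow>\<^sub>0 nat) \<Rightarrow>\<^sub>0 rat) \<Rightarrow> ('i \<Rightarrow> real) \<Rightarrow> real" where
  "rat_poly_eval P x =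
     (\<Sum>m\<in>Poly_Mapping.keys P. of_rat (Poly_Mapping.lookup P m) *
        (\<Prod>i\<in>Poly_Mapping.keys m. x i ^ Poly_Mapping.lookup m i))"

definition alg_independent_rat :: "'i set \<Rightarrow> ('i \<Rightarrow> real) \<Rightarrow> bool" where
  "alg_independent_rat I x \<longleftrightarrow>
     (\<forall>P. (\<forall>m\<in>Poly_Mapping.keys P. Poly_Mapping.keys m \<subseteq> I) \<and> rat_poly_eval P x = 0 \<longrightarrow> P = 0)"

text \<open>
  A framework is a graph together with a map \<open>p :: 'a \<Rightarrow> real ^ 2\<close>, of which only the values on
  the vertices matter.  Genericity concerns the coordinates as a family: coordinates of
  distinct points, and the two coordinates of one point, are distinct variables.
\<close>

definition generic_framework :: "'a pair_pre_digraph \<Rightarrow> ('a \<Rightarrow> real ^ 2) \<Rightarrow> bool" where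
  "generic_framework G p \<longleftrightarrow>
     alg_independent_rat (pverts G \<times> (UNIV :: 2 set)) (\<lambda>(v, k). vec_nth (p v) k)"

definition equivalent_frameworks ::
  "'a pair_pre_digraph \<Rightarrow> ('a \<Rightarrow> real ^ 2) \<Rightarrow> ('a \<Rightarrow> real ^ 2) \<Rightarrow> bool" where
  "equivalent_frameworks G p q \<longleftrightarrow> (\<forall>(u, v)\<in>parcs G. norm (p u - p v) = norm (q u - q v))"

definition congruent_frameworks ::
  "'a pair_pre_digraph \<Rightarrow> ('a \<Rightarrow> real ^ 2) \<Rightarrow> ('a \<Rightarrow> real ^ 2) \<Rightarrow> bool" where
  "congruent_frameworks G p q \<longleftrightarrow>
     (\<forall>u\<in>pverts G. \<forall>v\<in>pverts G. norm (p u - p v) = norm (q u - q v))"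

definition rigid_plane :: "'a pair_pre_digraph \<Rightarrow> bool" where
  "rigid_plane G \<longleftrightarrow>
     (\<forall>p. generic_framework G p \<longrightarrow>
        (\<exists>\<epsilon>>0. \<forall>q. equivalent_frameworks G p q \<and> (\<forall>u\<in>pverts G. norm (p u - q u) < \<epsilon>) \<longrightarrow>
           congruent_frameworks G p q))"

definition delete_edge :: "'a pair_pre_digraph \<Rightarrow> 'a \<Rightarrow> 'a \<Rightarrow> 'a pair_pre_digraph" where
  "delete_edge G u v = G\<lparr>parcs := parcs G - {(u, v), (v, u)}\<rparr>"

definition minimally_rigid_plane :: "'a pair_pre_digraph \<Rightarrow> bool" where
  "minimally_rigid_plane G \<longleftrightarrow>
     rigid_plane G \<and> (\<forall>(u, v)\<in>parcs G. \<not> rigid_plane (delete_edge G u v))"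

end

theory Submission
  imports Defs
begin

text \<open>
  Only two consequences of minimal rigidity matter: \<open>G\<close> has at most \<open>2n - 3\<close> edges and minimum degree
  at least 2.  For the first, take a maximal set \<open>B\<close> of edges whose squared lengths are algebraically
  independent polynomials in the coordinates.  In a generic framework the lengths of \<open>B\<close> leave only
  finitely many values for any other edge length, so \<open>B\<close> alone is already rigid and hence is all of
  \<open>G\<close>; and since up to congruence three coordinates vanish, at most \<open>2n - 3\<close> lengths are
  independent.  For the second, a vertex of degree at most 1 can be rotated about its neighbour.

  The row sum of \<open>A\<^sup>2 - A\<close> at \<open>u\<close> is \<open>2m - 2(n - 1)\<close> minus the sum of \<open>d(v) - 2\<close> over the
  non-neighbours \<open>v\<close> of \<open>u\<close>, so it is at most \<open>2(n - 2)\<close>, which gives \<open>\<rho>\<^sup>2 - \<rho> \<le> 2(n - 2)\<close>.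
  Equality forces every degree to be 2 or \<open>n - 1\<close>, with exactly two dominating vertices when \<open>n > 3\<close>.
\<close>

section \<open>Rational polynomials\<close>

definition monomial_eval :: "('i \<Rightarrow>\<^sub>0 nat) \<Rightarrow> ('i \<Rightarrow> real) \<Rightarrow> real" where
  "monomial_eval m x = (\<Prod>i\<in>Poly_Mapping.keys m. x i ^ Poly_Mapping.lookup m i)"

lemma rat_poly_eval_monomials:
  "rat_poly_eval P x = (\<Sum>m\<in>Poly_Mapping.keys P. of_rat (Poly_Mapping.lookup P m) * monomial_eval m x)"
  by (simp add: rat_poly_eval_def monomial_eval_def)

lemma monomial_eval_superset:
  assumes "finite K" "Poly_Mapping.keys m \<subseteq> K"
  shows "monomial_eval m x = (\<Prod>i\<in>K. x i ^ Poly_Mapping.lookup m i)"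
  unfolding monomial_eval_def using assms
  by (intro prod.mono_neutral_left) (auto simp: in_keys_iff)

lemma monomial_eval_add: "monomial_eval (m + m') x = monomial_eval m x * monomial_eval m' x"
proof -
  let ?K = "Poly_Mapping.keys m \<union> Poly_Mapping.keys m'"
  have "Poly_Mapping.keys (m + m') \<subseteq> ?K" by (rule keys_add)
  then show ?thesis
    by (simp add: monomial_eval_superset[of ?K] lookup_add power_add prod.distrib)
qed

lemma rat_poly_eval_superset:
  assumes "finite K" "Poly_Mapping.keys P \<subseteq> K"
  shows "rat_poly_eval P x = (\<Sum>m\<in>K. of_rat (Poly_Mapping.lookup P m) * monomial_eval m x)"
  unfolding rat_poly_eval_monomials using assms
  by (intro sum.mono_neutral_left) (auto simp: in_keys_iff)

lemma rat_poly_eval_0 [simp]: "rat_poly_eval 0 x = 0"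
  by (simp add: rat_poly_eval_def)

lemma rat_poly_eval_single:
  "rat_poly_eval (Poly_Mapping.single m c) x = of_rat c * monomial_eval m x"
  by (subst rat_poly_eval_superset[of "{m}"]) auto

lemma rat_poly_eval_add: "rat_poly_eval (P + Q) x = rat_poly_eval P x + rat_poly_eval Q x"
proof -
  let ?K = "Poly_Mapping.keys P \<union> Poly_Mapping.keys Q"
  have "Poly_Mapping.keys (P + Q) \<subseteq> ?K" by (rule keys_add)
  then show ?thesis
    by (simp add: rat_poly_eval_superset[of ?K] lookup_add of_rat_add ring_distribs sum.distrib)
qed

lemma rat_poly_eval_sum: "rat_poly_eval (\<Sum>a\<in>A. P a) x = (\<Sum>a\<in>A. rat_poly_eval (P a) x)"
  by (induction A rule: infinite_finite_induct) (auto simp: rat_poly_eval_add)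

lemma poly_mapping_sum_singles:
  "P = (\<Sum>m\<in>Poly_Mapping.keys P. Poly_Mapping.single m (Poly_Mapping.lookup P m))"
  by (rule poly_mapping_eqI)
    (auto simp: lookup_sum lookup_single when_def sum.delta not_in_keys_iff_lookup_eq_zero)

lemma rat_poly_eval_mult: "rat_poly_eval (P * Q) x = rat_poly_eval P x * rat_poly_eval Q x"
proof -
  have "P * Q = (\<Sum>m\<in>Poly_Mapping.keys P. \<Sum>m'\<in>Poly_Mapping.keys Q.
      Poly_Mapping.single (m + m') (Poly_Mapping.lookup P m * Poly_Mapping.lookup Q m'))"
    by (subst poly_mapping_sum_singles[of P], subst poly_mapping_sum_singles[of Q])
      (simp add: sum_product mult_single)
  then have "rat_poly_eval (P * Q) x = (\<Sum>m\<in>Poly_Mapping.keys P. \<Sum>m'\<in>Poly_Mapping.keys Q.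
      of_rat (Poly_Mapping.lookup P m * Poly_Mapping.lookup Q m') * monomial_eval (m + m') x)"
    by (simp add: rat_poly_eval_sum rat_poly_eval_single)
  then show ?thesis
    by (simp add: rat_poly_eval_monomials sum_product monomial_eval_add of_rat_mult ac_simps)
qed

lemma rat_poly_eval_cong:
  assumes "\<forall>m\<in>Poly_Mapping.keys P. Poly_Mapping.keys m \<subseteq> I" "\<And>i. i \<in> I \<Longrightarrow> x i = y i"
  shows "rat_poly_eval P x = rat_poly_eval P y"
proof -
  have "monomial_eval m x = monomial_eval m y" if "m \<in> Poly_Mapping.keys P" for m
    unfolding monomial_eval_def by (rule prod.cong) (use assms that in \<open>auto simp: subset_iff\<close>)
  then show ?thesis unfolding rat_poly_eval_monomials by simp
qed

text \<open>The bound is on each exponent separately, not on the total degree, so that there are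
  exactly \<open>(d + 1) ^ card I\<close> such monomials.\<close>

definition monomials_upto :: "'i set \<Rightarrow> nat \<Rightarrow> ('i \<Rightarrow>\<^sub>0 nat) set" where
  "monomials_upto I d = {m. Poly_Mapping.keys m \<subseteq> I \<and> (\<forall>i. Poly_Mapping.lookup m i \<le> d)}"

text \<open>Stated for functions instead of polynomials, so that compositions such as edge lengths
  are covered by closure rules that also track the exponent bound \<open>d\<close>.\<close>

definition rat_poly_fun :: "'i set \<Rightarrow> nat \<Rightarrow> (('i \<Rightarrow> real) \<Rightarrow> real) \<Rightarrow> bool" where
  "rat_poly_fun I d f \<longleftrightarrow>
     (\<exists>P. Poly_Mapping.keys P \<subseteq> monomials_upto I d \<and> (\<forall>x. f x = rat_poly_eval P x))"

lemma zero_in_monomials_upto: "0 \<in> monomials_upto I d"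
  by (simp add: monomials_upto_def)

lemma monomials_upto_add:
  "m \<in> monomials_upto I d \<Longrightarrow> m' \<in> monomials_upto I d' \<Longrightarrow> m + m' \<in> monomials_upto I (d + d')"
  using keys_add[of m m'] by (auto simp: monomials_upto_def lookup_add intro: add_mono)

lemma monomials_upto_mono: "d \<le> d' \<Longrightarrow> monomials_upto I d \<subseteq> monomials_upto I d'"
  unfolding monomials_upto_def using le_trans by blast

lemma rat_poly_fun_mono: "rat_poly_fun I d f \<Longrightarrow> d \<le> d' \<Longrightarrow> rat_poly_fun I d' f"
  unfolding rat_poly_fun_def using monomials_upto_mono[of d d' I] by (meson order_trans)

lemma rat_poly_fun_const: "rat_poly_fun I d (\<lambda>x. of_rat c)"
  unfolding rat_poly_fun_def
  by (rule exI[of _ "Poly_Mapping.single 0 c"])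
    (auto simp: rat_poly_eval_single zero_in_monomials_upto monomial_eval_def)

lemma rat_poly_fun_var: "i \<in> I \<Longrightarrow> rat_poly_fun I 1 (\<lambda>x. x i)"
  unfolding rat_poly_fun_def
  by (rule exI[of _ "Poly_Mapping.single (Poly_Mapping.single i 1) 1"])
    (auto simp: rat_poly_eval_single monomials_upto_def monomial_eval_def lookup_single when_def)

lemma rat_poly_fun_add:
  assumes "rat_poly_fun I d f" "rat_poly_fun I d g"
  shows "rat_poly_fun I d (\<lambda>x. f x + g x)"
proof -
  from assms obtain P Q where
    P: "Poly_Mapping.keys P \<subseteq> monomials_upto I d" "\<forall>x. f x = rat_poly_eval P x" and
    Q: "Poly_Mapping.keys Q \<subseteq> monomials_upto I d" "\<forall>x. g x = rat_poly_eval Q x"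
    unfolding rat_poly_fun_def by blast
  then show ?thesis
    unfolding rat_poly_fun_def using keys_add[of P Q]
    by (intro exI[of _ "P + Q"]) (auto simp: rat_poly_eval_add)
qed

lemma rat_poly_fun_mult:
  assumes "rat_poly_fun I d f" "rat_poly_fun I d' g"
  shows "rat_poly_fun I (d + d') (\<lambda>x. f x * g x)"
proof -
  from assms obtain P Q where
    P: "Poly_Mapping.keys P \<subseteq> monomials_upto I d" "\<forall>x. f x = rat_poly_eval P x" and
    Q: "Poly_Mapping.keys Q \<subseteq> monomials_upto I d'" "\<forall>x. g x = rat_poly_eval Q x"
    unfolding rat_poly_fun_def by blast
  then show ?thesis
    unfolding rat_poly_fun_def using keys_mult[of P Q]
    by (intro exI[of _ "P * Q"]) (force simp: rat_poly_eval_mult intro: monomials_upto_add)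
qed

lemma rat_poly_fun_power:
  assumes "rat_poly_fun I d f" shows "rat_poly_fun I (k * d) (\<lambda>x. f x ^ k)"
proof (induction k)
  case 0
  show ?case using rat_poly_fun_const[of I 0 1] by simp
next
  case (Suc k)
  show ?case using rat_poly_fun_mult[OF assms Suc] by simp
qed

lemma rat_poly_fun_prod:
  assumes "finite A" "\<And>a. a \<in> A \<Longrightarrow> rat_poly_fun I (d a) (f a)"
  shows "rat_poly_fun I (\<Sum>a\<in>A. d a) (\<lambda>x. \<Prod>a\<in>A. f a x)"
  using assms
proof (induction A rule: finite_induct)
  case empty
  show ?case using rat_poly_fun_const[of I 0 1] by simp
next
  case (insert a A)
  then show ?case using rat_poly_fun_mult[of I "d a" "f a"] by simp
qed

lemma rat_poly_fun_sum:
  assumes "finite A" "\<And>a. a \<in> A \<Longrightarrow> rat_poly_fun I d (f a)"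
  shows "rat_poly_fun I d (\<lambda>x. \<Sum>a\<in>A. f a x)"
  using assms
proof (induction A rule: finite_induct)
  case empty
  show ?case using rat_poly_fun_const[of I d 0] by simp
next
  case (insert a A)
  then show ?case using rat_poly_fun_add[of I d "f a"] by simp
qed

lemma rat_poly_fun_diff:
  assumes "rat_poly_fun I d f" "rat_poly_fun I d g"
  shows "rat_poly_fun I d (\<lambda>x. f x - g x)"
  using rat_poly_fun_add[OF assms(1) rat_poly_fun_mult[OF rat_poly_fun_const[of I 0 "-1"] assms(2),
    unfolded add_0]] by (simp add: of_rat_minus)

lemma rat_poly_fun_compose:
  assumes P: "\<forall>m\<in>Poly_Mapping.keys P. Poly_Mapping.keys m \<subseteq> B"
    and g: "\<And>b. b \<in> B \<Longrightarrow> rat_poly_fun I d (g b)"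
  shows "\<exists>d'. rat_poly_fun I d' (\<lambda>x. rat_poly_eval P (\<lambda>b. g b x))"
proof -
  \<comment> \<open>\<open>D m\<close> bounds the exponents in the monomial \<open>m\<close> after
    substitution. The bound for the whole polynomial is the maximum over its finitely many
    monomials.\<close>
  define D where "D m = (\<Sum>b\<in>Poly_Mapping.keys m. Poly_Mapping.lookup m b * d)" for m :: "'a \<Rightarrow>\<^sub>0 nat"
  have "rat_poly_fun I (D m) (\<lambda>x. monomial_eval m (\<lambda>b. g b x))" if "m \<in> Poly_Mapping.keys P" for m
    unfolding D_def monomial_eval_def using P g that
    by (intro rat_poly_fun_prod rat_poly_fun_power) auto
  then have "rat_poly_fun I (Max (D ` Poly_Mapping.keys P)) (\<lambda>x. monomial_eval m (\<lambda>b. g b x))"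
    if "m \<in> Poly_Mapping.keys P" for m
    by (rule rat_poly_fun_mono) (use that in auto)
  then have *: "rat_poly_fun I (0 + Max (D ` Poly_Mapping.keys P))
      (\<lambda>x. of_rat (Poly_Mapping.lookup P m) * monomial_eval m (\<lambda>b. g b x))"
    if "m \<in> Poly_Mapping.keys P" for m
    using that by (intro rat_poly_fun_mult rat_poly_fun_const)
  show ?thesis
    unfolding rat_poly_eval_monomials by (rule exI, rule rat_poly_fun_sum[OF finite_keys *])
qed

text \<open>This is how genericity is used: a polynomial that vanishes at one generic point is the
  zero polynomial, so it vanishes everywhere.\<close>

lemma rat_poly_fun_eq_0_if_alg_independent:
  assumes "rat_poly_fun I d f" "alg_independent_rat I x" "f x = 0"
  shows "f y = 0"
proof -
  from assms(1) obtain P where P: "Poly_Mapping.keys P \<subseteq> monomials_upto I d" "\<forall>x. f x = rat_poly_eval P x"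
    unfolding rat_poly_fun_def by blast
  then have "P = 0"
    using assms(2,3) unfolding alg_independent_rat_def by (metis (no_types, lifting) mem_Collect_eq monomials_upto_def subsetD)
  then show ?thesis using P by simp
qed

lemma bij_betw_monomials_upto:
  assumes "finite I"
  shows "bij_betw (\<lambda>m. restrict (Poly_Mapping.lookup m) I) (monomials_upto I d) (I \<rightarrow>\<^sub>E {..d})"
proof (rule bij_betw_byWitness[where f' = "\<lambda>g. Abs_poly_mapping (\<lambda>i. if i \<in> I then g i else 0)"])
  have fin: "finite {i. (if i \<in> I then g i else 0) \<noteq> 0}" for g :: "'a \<Rightarrow> nat"
    using assms by (rule rev_finite_subset) auto
  show "\<forall>m\<in>monomials_upto I d.
      Abs_poly_mapping (\<lambda>i. if i \<in> I then restrict (Poly_Mapping.lookup m) I i else 0) = m"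
    using fin by (auto intro!: poly_mapping_eqI simp: monomials_upto_def in_keys_iff)
  show "\<forall>g\<in>I \<rightarrow>\<^sub>E {..d}.
      restrict (Poly_Mapping.lookup (Abs_poly_mapping (\<lambda>i. if i \<in> I then g i else 0))) I = g"
    using fin by (auto simp: fun_eq_iff PiE_def extensional_def restrict_def)
  show "(\<lambda>m. restrict (Poly_Mapping.lookup m) I) ` monomials_upto I d \<subseteq> I \<rightarrow>\<^sub>E {..d}"
    by (auto simp: monomials_upto_def)
  show "(\<lambda>g. Abs_poly_mapping (\<lambda>i. if i \<in> I then g i else 0)) ` (I \<rightarrow>\<^sub>E {..d}) \<subseteq> monomials_upto I d"
    using fin by (auto simp: monomials_upto_def in_keys_iff PiE_def Pi_def split: if_splits)
qed

lemma finite_monomials_upto: "finite I \<Longrightarrow> finite (monomials_upto I d)"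
  by (simp add: bij_betw_finite[OF bij_betw_monomials_upto] finite_PiE)

lemma card_monomials_upto: "finite I \<Longrightarrow> card (monomials_upto I d) = Suc d ^ card I"
  by (simp add: bij_betw_same_card[OF bij_betw_monomials_upto] card_PiE)

section \<open>Algebraic independence of functions\<close>

text \<open>Gaussian elimination, by induction on the set \<open>N\<close> of equations;
  \<open>M\<close> is the set of unknowns.\<close>

lemma homogeneous_system_nontrivial_solution:
  fixes A :: "'m \<Rightarrow> 't \<Rightarrow> 'f::field"
  assumes "finite N" "finite M" "card N < card M"
  shows "\<exists>c. (\<exists>m\<in>M. c m \<noteq> 0) \<and> (\<forall>t\<in>N. (\<Sum>m\<in>M. c m * A m t) = 0)"
  using assms
proof (induction N arbitrary: M A rule: finite_induct)
  case empty
  then have "M \<noteq> {}" by auto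
  then show ?case by (intro exI[of _ "\<lambda>_. 1"]) auto
next
  case (insert t N)
  show ?case
  proof (cases "\<forall>m\<in>M. A m t = 0")
    case True
    obtain c where "\<exists>m\<in>M. c m \<noteq> 0" "\<forall>t\<in>N. (\<Sum>m\<in>M. c m * A m t) = 0"
      using insert.IH[of M A] insert.prems insert.hyps by auto
    then show ?thesis using True by (intro exI[of _ c]) auto
  next
    case False
    then obtain m0 where m0: "m0 \<in> M" "A m0 t \<noteq> 0" by blast
    define M' where "M' = M - {m0}"
    \<comment> \<open>Equation \<open>t\<close> is used to eliminate the unknown \<open>m0\<close>
      from every other equation.\<close>
    define A' where "A' m s = A m s - A m t / A m0 t * A m0 s" for m s
    have "card N < card M'" "finite M'"
      using insert.prems insert.hyps m0 by (auto simp: M'_def)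
    then obtain c where c: "\<exists>m\<in>M'. c m \<noteq> 0" "\<forall>s\<in>N. (\<Sum>m\<in>M'. c m * A' m s) = 0"
      using insert.IH[of M' A'] by auto
    \<comment> \<open>Back-substitution: the value at \<open>m0\<close> is the one that makes
      equation \<open>t\<close> hold.\<close>
    define e where "e = c(m0 := - (\<Sum>m\<in>M'. c m * A m t) / A m0 t)"
    have e: "(\<Sum>m\<in>M. e m * A m s) = (\<Sum>m\<in>M'. c m * A' m s)" for s
    proof -
      have "(\<Sum>m\<in>M. e m * A m s) = e m0 * A m0 s + (\<Sum>m\<in>M'. e m * A m s)"
        unfolding M'_def using insert.prems m0 by (intro sum.remove) auto
      also have "(\<Sum>m\<in>M'. e m * A m s) = (\<Sum>m\<in>M'. c m * A m s)"
        by (rule sum.cong) (auto simp: e_def M'_def)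
      also have "e m0 * A m0 s = - (\<Sum>m\<in>M'. c m * (A m t / A m0 t * A m0 s))"
        by (simp add: e_def sum_distrib_right sum_divide_distrib mult.assoc)
      finally show ?thesis by (simp add: A'_def right_diff_distrib sum_subtractf)
    qed
    have "\<exists>m\<in>M. e m \<noteq> 0" using c(1) by (auto simp: e_def M'_def)
    moreover have "(\<Sum>m\<in>M. e m * A m s) = 0" if "s \<in> insert t N" for s
      using c(2) that m0 unfolding e by (auto simp: A'_def)
    ultimately show ?thesis by blast
  qed
qed

text \<open>The variables are the indices, not the functions: two indices in \<open>B\<close> with
  the same function make the family dependent. Hence an independent set of lengths contains at most
  one orientation of an edge.\<close>

definition alg_independent_funs :: "'e set \<Rightarrow> ('e \<Rightarrow> 'p \<Rightarrow> real) \<Rightarrow> bool" where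
  "alg_independent_funs B L \<longleftrightarrow>
     (\<forall>P. (\<forall>m\<in>Poly_Mapping.keys P. Poly_Mapping.keys m \<subseteq> B) \<and>
        (\<forall>p. rat_poly_eval P (\<lambda>e. L e p) = 0) \<longrightarrow> P = 0)"

lemma rat_poly_eval_sum_singles:
  "rat_poly_eval (\<Sum>m\<in>M. Poly_Mapping.single m (c m)) x = (\<Sum>m\<in>M. of_rat (c m) * monomial_eval m x)"
  by (simp add: rat_poly_eval_sum rat_poly_eval_single)

text \<open>
  There are \<open>(D + 1) ^ card B\<close> monomials in the functions with exponents at most \<open>D\<close>, and they lie
  in a space of polynomials of dimension \<open>O(D ^ card I)\<close>.
\<close>

lemma card_le_if_alg_independent_funs:
  assumes "finite B" "finite I" and indep: "alg_independent_funs B L"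
    and L: "\<And>e. e \<in> B \<Longrightarrow> rat_poly_fun I d (L e)"
  shows "card B \<le> card I"
proof (rule ccontr)
  assume "\<not> card B \<le> card I"
  \<comment> \<open>\<open>K\<close> bounds the exponents after the functions are substituted into a
    monomial of \<open>M\<close>. With this \<open>D\<close> there are at most
    \<open>D * Suc D ^ card I\<close> monomials in \<open>N\<close>, fewer than
    \<open>Suc D ^ Suc (card I)\<close>, and \<open>M\<close> has at least that many.\<close>
  define D where "D = (card B * d + 1) ^ card I"
  define K where "K = card B * (D * d)"
  define M where "M = monomials_upto B D"
  define N where "N = monomials_upto I K"
  have fin: "finite M" "finite N" unfolding M_def N_def using assms finite_monomials_upto by auto
  have "Suc K \<le> (card B * d + 1) * Suc D" by (simp add: K_def algebra_simps)
  then have "Suc K ^ card I \<le> ((card B * d + 1) * Suc D) ^ card I" by (rule power_mono) simp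
  also have "\<dots> = D * Suc D ^ card I" by (simp only: D_def power_mult_distrib)
  also have "\<dots> < Suc D ^ Suc (card I)" by simp
  also have "\<dots> \<le> Suc D ^ card B" using \<open>\<not> card B \<le> card I\<close> by (intro power_increasing) auto
  finally have "card N < card M"
    unfolding M_def N_def using assms by (simp add: card_monomials_upto)
  have "\<exists>Q. Poly_Mapping.keys Q \<subseteq> N \<and> (\<forall>x. monomial_eval m (\<lambda>e. L e x) = rat_poly_eval Q x)"
    if "m \<in> M" for m
  proof -
    have m: "Poly_Mapping.keys m \<subseteq> B" "\<And>i. Poly_Mapping.lookup m i \<le> D"
      using that by (auto simp: M_def monomials_upto_def)
    have "rat_poly_fun I (\<Sum>b\<in>Poly_Mapping.keys m. Poly_Mapping.lookup m b * d)
        (\<lambda>x. monomial_eval m (\<lambda>e. L e x))"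
      unfolding monomial_eval_def using L m
      by (intro rat_poly_fun_prod rat_poly_fun_power) auto
    moreover have "(\<Sum>b\<in>Poly_Mapping.keys m. Poly_Mapping.lookup m b * d) \<le>
        (\<Sum>b\<in>Poly_Mapping.keys m. D * d)"
      using m by (intro sum_mono mult_right_mono) auto
    moreover have "\<dots> \<le> K"
      using card_mono[OF \<open>finite B\<close> m(1)] by (simp add: K_def)
    ultimately have "rat_poly_fun I K (\<lambda>x. monomial_eval m (\<lambda>e. L e x))"
      using rat_poly_fun_mono order_trans by blast
    then show ?thesis unfolding rat_poly_fun_def N_def .
  qed
  then obtain Q where Q: "\<And>m. m \<in> M \<Longrightarrow> Poly_Mapping.keys (Q m) \<subseteq> N"
    "\<And>m x. m \<in> M \<Longrightarrow> monomial_eval m (\<lambda>e. L e x) = rat_poly_eval (Q m) x" by metis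
  \<comment> \<open>A combination of the \<open>Q m\<close> in which every coefficient cancels; the
    same combination of monomials is an algebraic relation.\<close>
  obtain c where c: "\<exists>m\<in>M. c m \<noteq> 0" "\<And>t. t \<in> N \<Longrightarrow> (\<Sum>m\<in>M. c m * Poly_Mapping.lookup (Q m) t) = 0"
    using homogeneous_system_nontrivial_solution[OF fin(2,1) \<open>card N < card M\<close>,
      of "\<lambda>m. Poly_Mapping.lookup (Q m)"] by blast
  define P where "P = (\<Sum>m\<in>M. Poly_Mapping.single m (c m))"
  have P: "Poly_Mapping.lookup P m = (if m \<in> M then c m else 0)" for m
    using fin by (simp add: P_def lookup_sum lookup_single when_def sum.delta)
  have "rat_poly_eval P (\<lambda>e. L e x) = 0" for x
  proof -
    have "rat_poly_eval P (\<lambda>e. L e x) = (\<Sum>m\<in>M. of_rat (c m) * rat_poly_eval (Q m) x)"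
      unfolding P_def rat_poly_eval_sum_singles using Q(2) by (intro sum.cong) auto
    also have "\<dots> = (\<Sum>m\<in>M. \<Sum>t\<in>N. of_rat (c m * Poly_Mapping.lookup (Q m) t) * monomial_eval t x)"
      using Q(1) fin
      by (intro sum.cong) (auto simp: rat_poly_eval_superset sum_distrib_left of_rat_mult ac_simps)
    also have "\<dots> = (\<Sum>t\<in>N. of_rat (\<Sum>m\<in>M. c m * Poly_Mapping.lookup (Q m) t) * monomial_eval t x)"
      by (subst sum.swap) (simp add: of_rat_sum sum_distrib_right)
    also have "\<dots> = 0" using c(2) by simp
    finally show ?thesis .
  qed
  moreover have "\<forall>m\<in>Poly_Mapping.keys P. Poly_Mapping.keys m \<subseteq> B"
    using P by (metis (mono_tags, lifting) M_def in_keys_iff mem_Collect_eq monomials_upto_def)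
  ultimately have "P = 0" using indep unfolding alg_independent_funs_def by blast
  then show False using c(1) P by (metis lookup_zero)
qed

text \<open>\<open>C\<close> is a coefficient of \<open>P\<close>, read as a polynomial in the variable \<open>e\<close>.\<close>

lemma finite_roots_in_variable:
  assumes "P \<noteq> 0" and vars: "\<forall>m\<in>Poly_Mapping.keys P. Poly_Mapping.keys m \<subseteq> insert e B"
  obtains C where "C \<noteq> 0" "\<forall>m\<in>Poly_Mapping.keys C. Poly_Mapping.keys m \<subseteq> B"
    "\<And>y. rat_poly_eval C y \<noteq> 0 \<Longrightarrow> finite {t. rat_poly_eval P (y(e := t)) = 0}"
proof -
  define del where "del m = Poly_Mapping.update e 0 m" for m :: "'a \<Rightarrow>\<^sub>0 nat"
  have split: "m = del m + Poly_Mapping.single e (Poly_Mapping.lookup m e)" for m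
    by (rule poly_mapping_eqI) (simp add: del_def lookup_update lookup_add lookup_single when_def)
  have keys_del: "Poly_Mapping.keys (del m) = Poly_Mapping.keys m - {e}" for m
    by (simp add: del_def keys_update)
  have mon: "monomial_eval m (y(e := t)) = monomial_eval (del m) y * t ^ Poly_Mapping.lookup m e" for m y t
  proof -
    have "monomial_eval m (y(e := t)) = monomial_eval (del m) (y(e := t)) *
        monomial_eval (Poly_Mapping.single e (Poly_Mapping.lookup m e)) (y(e := t))"
      by (subst split) (rule monomial_eval_add)
    also have "monomial_eval (del m) (y(e := t)) = monomial_eval (del m) y"
      unfolding monomial_eval_def by (rule prod.cong) (auto simp: keys_del)
    also have "monomial_eval (Poly_Mapping.single e (Poly_Mapping.lookup m e)) (y(e := t)) =
        t ^ Poly_Mapping.lookup m e"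
      by (simp add: monomial_eval_def)
    finally show ?thesis .
  qed
  obtain m0 where m0: "m0 \<in> Poly_Mapping.keys P" using \<open>P \<noteq> 0\<close> by (metis in_keys_iff lookup_zero poly_mapping_eqI)
  \<comment> \<open>The chosen coefficient is that of the \<open>j\<close>-th power of
    \<open>e\<close>, where \<open>j\<close> is the exponent of \<open>e\<close> in some monomial
    \<open>m0\<close> of \<open>P\<close>.\<close>
  define j where "j = Poly_Mapping.lookup m0 e"
  define M where "M = {m \<in> Poly_Mapping.keys P. Poly_Mapping.lookup m e = j}"
  define C where "C = (\<Sum>m\<in>M. Poly_Mapping.single (del m) (Poly_Mapping.lookup P m))"
  have "finite M" by (simp add: M_def)
  \<comment> \<open>Among monomials with the same exponent of \<open>e\<close>, deleting
    \<open>e\<close> loses nothing, so the coefficient of \<open>m0\<close> in \<open>P\<close>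
    survives in \<open>C\<close> without cancellation.\<close>
  have "del m = del m0 \<longleftrightarrow> m = m0" if "m \<in> M" for m
    using split[of m] split[of m0] that by (auto simp: M_def j_def)
  then have "Poly_Mapping.lookup C (del m0) =
      (\<Sum>m\<in>M. if m = m0 then Poly_Mapping.lookup P m else 0)"
    unfolding C_def lookup_sum by (intro sum.cong) (auto simp: lookup_single when_def)
  also have "\<dots> = Poly_Mapping.lookup P m0"
    using m0 \<open>finite M\<close> by (simp add: sum.delta' M_def j_def)
  finally have "C \<noteq> 0" using m0 by (auto simp: in_keys_iff)
  moreover have "Poly_Mapping.keys m \<subseteq> B" if "m \<in> Poly_Mapping.keys C" for m
  proof -
    have "m \<in> del ` M" using that keys_sum[of "\<lambda>m. Poly_Mapping.single (del m) (Poly_Mapping.lookup P m)" M]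
      by (auto simp: C_def split: if_splits)
    then show ?thesis using vars by (fastforce simp: M_def keys_del)
  qed
  moreover have "finite {t. rat_poly_eval P (y(e := t)) = 0}" if "rat_poly_eval C y \<noteq> 0" for y
  proof -
    \<comment> \<open>\<open>r\<close> is \<open>P\<close> with all variables but \<open>e\<close>
      set to \<open>y\<close>, a univariate polynomial whose coefficient at \<open>j\<close> is the
      value of \<open>C\<close>.\<close>
    define r where "r = (\<Sum>m\<in>Poly_Mapping.keys P. Polynomial.monom
      (of_rat (Poly_Mapping.lookup P m) * monomial_eval (del m) y) (Poly_Mapping.lookup m e))"
    have "Polynomial.coeff r j = (\<Sum>m\<in>Poly_Mapping.keys P. if Poly_Mapping.lookup m e = j
        then of_rat (Poly_Mapping.lookup P m) * monomial_eval (del m) y else 0)"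
      by (simp add: r_def Polynomial.coeff_sum)
    also have "\<dots> = rat_poly_eval C y"
      unfolding C_def rat_poly_eval_sum rat_poly_eval_single M_def by (simp only: sum.inter_filter finite_keys)
    finally have "r \<noteq> 0" using that by auto
    moreover have "rat_poly_eval P (y(e := t)) = poly r t" for t
      by (simp add: r_def rat_poly_eval_monomials mon Polynomial.poly_sum poly_monom ac_simps)
    ultimately show ?thesis by (simp add: poly_roots_finite)
  qed
  ultimately show thesis using that by blast
qed

section \<open>Edge lengths and rigidity\<close>

text \<open>Squared, so that the length is a polynomial in the coordinates.\<close>

definition sq_length :: "'a \<times> 'a \<Rightarrow> ('a \<Rightarrow> real ^ 2) \<Rightarrow> real" where
  "sq_length e p = (norm (p (fst e) - p (snd e)))\<^sup>2"

lemma sq_length_coords: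
  "sq_length e p = (vec_nth (p (fst e)) 1 - vec_nth (p (snd e)) 1)\<^sup>2 +
     (vec_nth (p (fst e)) 2 - vec_nth (p (snd e)) 2)\<^sup>2"
  unfolding sq_length_def power2_norm_eq_inner
  by (simp add: inner_vec_def sum_2 power2_eq_square)

lemma rat_poly_fun_sq_length:
  assumes "\<And>v k. v \<in> {fst e, snd e} \<Longrightarrow> rat_poly_fun I 1 (\<lambda>x. vec_nth (g x v) k)"
  shows "rat_poly_fun I 2 (\<lambda>x. sq_length e (g x))"
proof -
  have "rat_poly_fun I (2 * 1) (\<lambda>x. (vec_nth (g x (fst e)) k - vec_nth (g x (snd e)) k)\<^sup>2)" for k
    using assms by (intro rat_poly_fun_power rat_poly_fun_diff) auto
  then show ?thesis unfolding sq_length_coords by (intro rat_poly_fun_add) auto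
qed

definition vec_of_coords :: "('a \<times> 2 \<Rightarrow> real) \<Rightarrow> 'a \<Rightarrow> real ^ 2" where
  "vec_of_coords x v = (\<chi> k. x (v, k))"

lemma vec_of_coords_coords: "vec_of_coords (\<lambda>(v, k). vec_nth (p v) k) = p"
  by (simp add: vec_of_coords_def fun_eq_iff vec_eq_iff)

text \<open>If \<open>C\<close> vanished on the lengths at the generic \<open>p\<close>, it would
  vanish on the lengths of every framework and so be a relation among the lengths of
  \<open>B\<close>.\<close>

lemma rat_poly_eval_sq_length_nonzero:
  fixes p :: "'a \<Rightarrow> real ^ 2"
  assumes B: "B \<subseteq> W \<times> W" and indep: "alg_independent_funs B sq_length"
    and generic: "alg_independent_rat (W \<times> UNIV) (\<lambda>(v, k). vec_nth (p v) k)"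
    and C: "C \<noteq> 0" "\<forall>m\<in>Poly_Mapping.keys C. Poly_Mapping.keys m \<subseteq> B"
  shows "rat_poly_eval C (\<lambda>b. sq_length b p) \<noteq> 0"
proof
  assume zero: "rat_poly_eval C (\<lambda>b. sq_length b p) = 0"
  have "rat_poly_fun (W \<times> UNIV) 2 (\<lambda>x. sq_length b (vec_of_coords x))" if "b \<in> B" for b
    using subsetD[OF B that]
    by (intro rat_poly_fun_sq_length) (auto simp: vec_of_coords_def intro!: rat_poly_fun_var[unfolded One_nat_def])
  then obtain d where
    d: "rat_poly_fun (W \<times> UNIV) d (\<lambda>x. rat_poly_eval C (\<lambda>b. sq_length b (vec_of_coords x)))"
    using rat_poly_fun_compose[OF C(2), of "W \<times> UNIV" 2 "\<lambda>b x. sq_length b (vec_of_coords x)"] by blast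
  have "rat_poly_eval C (\<lambda>b. sq_length b (vec_of_coords (\<lambda>(v, k). vec_nth (p v) k))) = 0"
    using zero by (simp add: vec_of_coords_coords)
  then have "rat_poly_eval C (\<lambda>b. sq_length b (vec_of_coords x)) = 0" for x
    by (rule rat_poly_fun_eq_0_if_alg_independent[OF d generic])
  then have "rat_poly_eval C (\<lambda>b. sq_length b q) = 0" for q
    by (metis vec_of_coords_coords)
  then show False using indep C unfolding alg_independent_funs_def by blast
qed

text \<open>
  The length of \<open>e\<close> is algebraic over the lengths of \<open>B\<close>, so these leave only finitely many values
  for it, and values other than the one at \<open>p\<close> are not attained near \<open>p\<close>.
\<close>

lemma length_locally_determined:
  fixes p :: "'a \<Rightarrow> real ^ 2"
  assumes B: "B \<subseteq> W \<times> W" and e: "e \<in> W \<times> W" and indep: "alg_independent_funs B sq_length"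
    and dep: "\<not> alg_independent_funs (insert e B) sq_length"
    and generic: "alg_independent_rat (W \<times> UNIV) (\<lambda>(v, k). vec_nth (p v) k)"
  shows "\<exists>\<epsilon>>0. \<forall>q. (\<forall>b\<in>B. sq_length b p = sq_length b q) \<and> (\<forall>u\<in>W. norm (p u - q u) < \<epsilon>) \<longrightarrow>
    norm (p (fst e) - p (snd e)) = norm (q (fst e) - q (snd e))"
proof -
  obtain P where P: "P \<noteq> 0" "\<forall>m\<in>Poly_Mapping.keys P. Poly_Mapping.keys m \<subseteq> insert e B"
    "\<And>q. rat_poly_eval P (\<lambda>b. sq_length b q) = 0"
    using dep unfolding alg_independent_funs_def by blast
  obtain C where C: "C \<noteq> 0" "\<forall>m\<in>Poly_Mapping.keys C. Poly_Mapping.keys m \<subseteq> B"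
    "\<And>y. rat_poly_eval C y \<noteq> 0 \<Longrightarrow> finite {t. rat_poly_eval P (y(e := t)) = 0}"
    using finite_roots_in_variable[OF P(1,2)] by blast
  \<comment> \<open>The squared lengths of \<open>e\<close> that the relation \<open>P\<close>
    permits once the lengths of \<open>B\<close> are those at \<open>p\<close>.\<close>
  define T where "T = {t. rat_poly_eval P ((\<lambda>b. sq_length b p)(e := t)) = 0}"
  have "finite (sqrt ` T)"
    unfolding T_def by (intro finite_imageI C(3) rat_poly_eval_sq_length_nonzero[OF B indep generic C(1,2)])
  then obtain \<delta> where \<delta>: "\<delta> > 0" "\<And>x. x \<in> sqrt ` T \<Longrightarrow> x \<noteq> norm (p (fst e) - p (snd e)) \<Longrightarrow>
      \<delta> \<le> dist (norm (p (fst e) - p (snd e))) x"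
    using finite_set_avoid by metis
  have "norm (p (fst e) - p (snd e)) = norm (q (fst e) - q (snd e))"
    if q: "\<forall>b\<in>B. sq_length b p = sq_length b q" "\<forall>u\<in>W. norm (p u - q u) < \<delta> / 2" for q
  proof -
    have "rat_poly_eval P ((\<lambda>b. sq_length b p)(e := sq_length e q)) = rat_poly_eval P (\<lambda>b. sq_length b q)"
      using q(1) by (intro rat_poly_eval_cong[OF P(2)]) auto
    then have "sqrt (sq_length e q) \<in> sqrt ` T" using P(3) by (simp add: T_def)
    then have T: "norm (q (fst e) - q (snd e)) \<in> sqrt ` T" by (simp add: sq_length_def)
    have "norm (p (fst e) - q (fst e)) < \<delta> / 2" "norm (p (snd e) - q (snd e)) < \<delta> / 2"
      using q(2) e by auto
    then have "dist (norm (p (fst e) - p (snd e))) (norm (q (fst e) - q (snd e))) < \<delta>"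
      using norm_triangle_ineq4[of "p (fst e) - q (fst e)" "p (snd e) - q (snd e)"]
        norm_triangle_ineq3[of "p (fst e) - p (snd e)" "q (fst e) - q (snd e)"]
      by (simp add: dist_real_def algebra_simps)
    then show ?thesis using \<delta>(2)[OF T] by linarith
  qed
  then show ?thesis using \<delta>(1) by (intro exI[of _ "\<delta> / 2"]) auto
qed

section \<open>At most 2n - 3 independent lengths\<close>

text \<open>\<open>c\<close> and \<open>s\<close> are the cosine and sine of the angle of
  \<open>(a, b)\<close>, so rotating back by this angle gives second coordinate
  \<open>c * b - s * a = 0\<close>.\<close>

lemma rotation_to_axis:
  fixes a b :: real
  obtains c s where "c\<^sup>2 + s\<^sup>2 = 1" "c * b = s * a"
proof (cases "a = 0 \<and> b = 0")
  case True
  then show thesis using that[of 1 0] by simp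
next
  case False
  define r where "r = sqrt (a\<^sup>2 + b\<^sup>2)"
  have r: "r\<^sup>2 = a\<^sup>2 + b\<^sup>2" "r \<noteq> 0" using False by (auto simp: r_def sum_power2_eq_zero_iff)
  then have "a\<^sup>2 + b\<^sup>2 \<noteq> 0" by (metis power_eq_0_iff)
  then have "(a / r)\<^sup>2 + (b / r)\<^sup>2 = 1" using r by (simp add: power_divide add_divide_distrib[symmetric])
  then show thesis using that[of "a / r" "b / r"] by simp
qed

text \<open>Translate \<open>a\<close> to the origin and rotate \<open>b\<close> onto the first
  axis. All lengths are kept, and they become polynomials in the remaining
  \<open>2 * card W - 3\<close> coordinates.\<close>

lemma card_alg_independent_lengths:
  fixes B :: "('a \<times> 'a) set"
  assumes "finite W" "card W \<ge> 2" and B: "B \<subseteq> W \<times> W" and indep: "alg_independent_funs B sq_length"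
  shows "card B \<le> 2 * card W - 3"
proof -
  obtain a b where ab: "a \<in> W" "b \<in> W" "a \<noteq> b"
    using assms(1,2) by (metis card_le_Suc0_iff_eq not_less_eq_eq numeral_2_eq_2)
  define I where "I = W \<times> (UNIV :: 2 set) - {(a, 1), (a, 2), (b, 2)}"
  have "finite I" using assms by (simp add: I_def)
  have "card I = card (W \<times> (UNIV :: 2 set)) - card {(a, 1::2), (a, 2), (b, 2)}"
    unfolding I_def using ab by (intro card_Diff_subset) auto
  then have "card I = 2 * card W - 3" using ab by (simp add: card_cartesian_product)
  \<comment> \<open>The framework in normal position with free coordinates \<open>x\<close>.\<close>
  define g where "g x v = (\<chi> k. if (v, k) \<in> I then x (v, k) else 0)" for x :: "'a \<times> 2 \<Rightarrow> real" and v
  have normalise: "\<exists>x. \<forall>e\<in>B. sq_length e p = sq_length e (g x)" for p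
  proof -
    define w where "w v k = vec_nth (p v) k - vec_nth (p a) k" for v k
    obtain c s where cs: "c\<^sup>2 + s\<^sup>2 = 1" "c * w b 2 = s * w b 1"
      using rotation_to_axis by blast
    define x where "x = (\<lambda>(v, k). if k = (1::2) then c * w v 1 + s * w v 2 else c * w v 2 - s * w v 1)"
    have gx: "vec_nth (g x v) 1 = c * w v 1 + s * w v 2" "vec_nth (g x v) 2 = c * w v 2 - s * w v 1"
      if "v \<in> W" for v
      using that cs(2) by (auto simp: g_def I_def x_def w_def)
    have "sq_length e p = sq_length e (g x)" if "e \<in> B" for e
    proof -
      have "e \<in> W \<times> W" using B that by blast
      then obtain u v where e: "e = (u, v)" "u \<in> W" "v \<in> W" by auto
      have "sq_length e (g x) = (c\<^sup>2 + s\<^sup>2) * ((w u 1 - w v 1)\<^sup>2 + (w u 2 - w v 2)\<^sup>2)"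
        using e by (simp add: sq_length_coords gx) (simp add: power2_eq_square algebra_simps)
      then show ?thesis using cs e by (simp add: sq_length_coords w_def)
    qed
    then show ?thesis by blast
  qed
  \<comment> \<open>Every system of lengths is realised in normal position, so a relation that holds
    there holds for all frameworks.\<close>
  have "alg_independent_funs B (\<lambda>e x. sq_length e (g x))"
    unfolding alg_independent_funs_def
  proof (intro allI impI)
    fix P
    assume P: "(\<forall>m\<in>Poly_Mapping.keys P. Poly_Mapping.keys m \<subseteq> B) \<and>
      (\<forall>x. rat_poly_eval P (\<lambda>e. sq_length e (g x)) = 0)"
    have "rat_poly_eval P (\<lambda>e. sq_length e p) = 0" for p
    proof -
      obtain x where "\<forall>e\<in>B. sq_length e p = sq_length e (g x)" using normalise by blast
      then have "rat_poly_eval P (\<lambda>e. sq_length e p) = rat_poly_eval P (\<lambda>e. sq_length e (g x))"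
        using P by (intro rat_poly_eval_cong[of P B]) auto
      then show ?thesis using P by simp
    qed
    then show "P = 0" using indep P unfolding alg_independent_funs_def by blast
  qed
  moreover have "rat_poly_fun I 2 (\<lambda>x. sq_length e (g x))" for e
  proof (rule rat_poly_fun_sq_length)
    show "rat_poly_fun I 1 (\<lambda>x. vec_nth (g x v) k)" for v k
      using rat_poly_fun_const[of I 1 0] rat_poly_fun_var[of "(v, k)" I]
      by (cases "(v, k) \<in> I") (simp_all add: g_def)
  qed
  moreover have "finite B" using B \<open>finite W\<close> by (meson finite_SigmaI finite_subset)
  ultimately show ?thesis
    using card_le_if_alg_independent_funs \<open>finite I\<close> \<open>card I = 2 * card W - 3\<close> by metis
qed

text \<open>Near a generic \<open>p\<close>, the lengths of \<open>B\<close> fix the lengths of all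
  edges of \<open>G\<close>, so a nearby framework equivalent for \<open>H\<close> is equivalent for
  \<open>G\<close>. Genericity and congruence depend on the vertices alone and pass between the two
  graphs.\<close>

lemma rigid_plane_if_alg_maximal:
  assumes "pair_graph G" and "rigid_plane G"
    and B: "B \<subseteq> parcs G" and indep: "alg_independent_funs B sq_length"
    and maximal: "\<And>e. e \<in> parcs G - B \<Longrightarrow> \<not> alg_independent_funs (insert e B) sq_length"
    and H: "pverts H = pverts G" "B \<subseteq> parcs H"
  shows "rigid_plane H"
  unfolding rigid_plane_def
proof (intro allI impI)
  interpret pair_graph G by fact
  fix p :: "'a \<Rightarrow> real ^ 2"
  assume gen: "generic_framework H p"
  have parcs: "parcs G \<subseteq> pverts G \<times> pverts G" using in_arcsD1 in_arcsD2 by auto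
  have "\<exists>\<epsilon>>0. \<forall>q. (\<forall>b\<in>B. sq_length b p = sq_length b q) \<and> (\<forall>u\<in>pverts G. norm (p u - q u) < \<epsilon>) \<longrightarrow>
    norm (p (fst e) - p (snd e)) = norm (q (fst e) - q (snd e))" if "e \<in> parcs G" for e
  proof (cases "e \<in> B")
    case True
    then show ?thesis by (intro exI[of _ 1]) (auto simp: sq_length_def)
  next
    case False
    show ?thesis
      using B parcs that False gen maximal indep H
      by (intro length_locally_determined[of B "pverts G"]) (auto simp: generic_framework_def)
  qed
  then obtain E where E: "\<And>e. e \<in> parcs G \<Longrightarrow> E e > 0"
    "\<And>e q. e \<in> parcs G \<Longrightarrow> \<forall>b\<in>B. sq_length b p = sq_length b q \<Longrightarrow>
      \<forall>u\<in>pverts G. norm (p u - q u) < E e \<Longrightarrow>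
      norm (p (fst e) - p (snd e)) = norm (q (fst e) - q (snd e))" by metis
  have "generic_framework G p" using gen H by (simp add: generic_framework_def)
  then obtain \<epsilon> where \<epsilon>: "\<epsilon> > 0" "\<And>q. equivalent_frameworks G p q \<Longrightarrow>
      \<forall>u\<in>pverts G. norm (p u - q u) < \<epsilon> \<Longrightarrow> congruent_frameworks G p q"
    using \<open>rigid_plane G\<close> unfolding rigid_plane_def by blast
  define \<delta> where "\<delta> = Min (insert \<epsilon> (E ` parcs G))"
  have "\<delta> > 0" using E(1) \<epsilon>(1) by (auto simp: \<delta>_def)
  have \<delta>: "\<delta> \<le> \<epsilon>" "\<And>e. e \<in> parcs G \<Longrightarrow> \<delta> \<le> E e" by (auto simp: \<delta>_def)
  have "congruent_frameworks H p q"
    if eq: "equivalent_frameworks H p q" and close: "\<forall>u\<in>pverts H. norm (p u - q u) < \<delta>" for q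
  proof -
    have "\<forall>b\<in>B. sq_length b p = sq_length b q"
      using eq H by (fastforce simp: equivalent_frameworks_def sq_length_def)
    then have "norm (p (fst e) - p (snd e)) = norm (q (fst e) - q (snd e))" if "e \<in> parcs G" for e
    proof (rule E(2)[OF that])
      show "\<forall>u\<in>pverts G. norm (p u - q u) < E e"
        using close H \<delta>(2)[OF that] by (metis less_le_trans)
    qed
    then have "equivalent_frameworks G p q" by (auto simp: equivalent_frameworks_def)
    then have "congruent_frameworks G p q" using \<epsilon>(2)[of q] close \<delta>(1) H by (metis less_le_trans)
    then show ?thesis using H by (simp add: congruent_frameworks_def)
  qed
  then show "\<exists>\<epsilon>>0. \<forall>q. equivalent_frameworks H p q \<and> (\<forall>u\<in>pverts H. norm (p u - q u) < \<epsilon>) \<longrightarrow>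
      congruent_frameworks H p q"
    using \<open>\<delta> > 0\<close> by blast
qed

text \<open>The outer factor 2 appears because \<open>parcs\<close> holds each edge in both
  orientations.\<close>

lemma minimally_rigid_card_parcs:
  assumes "pair_graph G" and "minimally_rigid_plane G" and "card (pverts G) \<ge> 2"
  shows "card (parcs G) \<le> 2 * (2 * card (pverts G) - 3)"
proof -
  interpret pair_graph G by fact
  let ?ind = "\<lambda>B. B \<subseteq> parcs G \<and> alg_independent_funs B sq_length"
  \<comment> \<open>A polynomial without variables is a constant. This makes the family of
    independent sets nonempty, so that a maximal one exists.\<close>
  have "alg_independent_funs {} (sq_length :: 'a \<times> 'a \<Rightarrow> _)"
    unfolding alg_independent_funs_def
  proof (intro allI impI)
    fix P :: "(('a \<times> 'a) \<Rightarrow>\<^sub>0 nat) \<Rightarrow>\<^sub>0 rat"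
    assume P: "(\<forall>m\<in>Poly_Mapping.keys P. Poly_Mapping.keys m \<subseteq> {}) \<and>
      (\<forall>p. rat_poly_eval P (\<lambda>e. sq_length e p) = 0)"
    have "m = 0" if "m \<in> Poly_Mapping.keys P" for m
    proof -
      have "Poly_Mapping.keys m = {}" using P that by blast
      then show "m = 0" by (intro poly_mapping_eqI) (metis empty_iff in_keys_iff lookup_zero)
    qed
    then have keys: "Poly_Mapping.keys P \<subseteq> {0}" by blast
    then have "of_rat (Poly_Mapping.lookup P 0) = (0 :: real)"
      using P by (simp add: rat_poly_eval_superset[of "{0}"] monomial_eval_def)
    then show "P = 0" using keys by (intro poly_mapping_eqI) (auto simp: in_keys_iff)
  qed
  then have "{B. ?ind B} \<noteq> {}" by auto
  moreover have "finite {B. ?ind B}"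
    by (rule finite_subset[of _ "Pow (parcs G)"]) (use pair_finite_arcs in auto)
  ultimately have "\<exists>B\<in>{B. ?ind B}. \<forall>B'\<in>{B. ?ind B}. B \<subseteq> B' \<longrightarrow> B = B'"
    by (intro finite_has_maximal)
  then obtain B where B: "?ind B" and max: "\<And>B'. ?ind B' \<Longrightarrow> B \<subseteq> B' \<Longrightarrow> B = B'"
    by (elim bexE) simp
  \<comment> \<open>Deleting an edge with neither orientation in \<open>B\<close> would leave a
    graph that still contains \<open>B\<close>, hence a rigid one, against minimality.\<close>
  have "parcs G \<subseteq> B \<union> prod.swap ` B"
  proof
    fix e assume e: "e \<in> parcs G"
    obtain u v where uv: "e = (u, v)" by (cases e)
    have "\<not> rigid_plane (delete_edge G u v)"
      using assms(2) e uv by (auto simp: minimally_rigid_plane_def)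
    moreover have "rigid_plane G" using assms(2) by (simp add: minimally_rigid_plane_def)
    moreover have "\<not> alg_independent_funs (insert f B) sq_length" if "f \<in> parcs G - B" for f
      using max[of "insert f B"] B that by auto
    ultimately have "\<not> B \<subseteq> parcs (delete_edge G u v)"
      using rigid_plane_if_alg_maximal[of G B "delete_edge G u v"] B \<open>pair_graph G\<close>
      by (auto simp: delete_edge_def)
    then show "e \<in> B \<union> prod.swap ` B" using B uv by (force simp: delete_edge_def)
  qed
  moreover have "finite B" using B pair_finite_arcs finite_subset by blast
  ultimately have "card (parcs G) \<le> card B + card B"
    by (meson card_Un_le card_image_le card_mono finite_UnI finite_imageI add_left_mono le_trans)
  moreover have "card B \<le> 2 * card (pverts G) - 3"
    using B in_arcsD1 in_arcsD2 assms(3) pair_finite_verts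
    by (intro card_alg_independent_lengths) auto
  ultimately show ?thesis by simp
qed

section \<open>Minimum degree of a rigid graph\<close>

lemma norm_vec2: "(norm (v :: real ^ 2))\<^sup>2 = (vec_nth v 1)\<^sup>2 + (vec_nth v 2)\<^sup>2"
  unfolding power2_norm_eq_inner by (simp add: inner_vec_def sum_2 power2_eq_square)

lemma norm_rotation_eq:
  fixes a :: "real ^ 2"
  shows "norm (cos t *\<^sub>R a + sin t *\<^sub>R vector [- vec_nth a 2, vec_nth a 1]) = norm a"
proof -
  let ?b = "cos t *\<^sub>R a + sin t *\<^sub>R vector [- vec_nth a 2, vec_nth a 1]"
  have "(norm ?b)\<^sup>2 = ((cos t)\<^sup>2 + (sin t)\<^sup>2) * (norm a)\<^sup>2"
    unfolding norm_vec2
    by (simp add: power2_eq_square algebra_simps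
      del: sin_cos_squared_add sin_cos_squared_add2 sin_cos_squared_add3)
  then have "(norm ?b)\<^sup>2 = (norm a)\<^sup>2" by simp
  then show ?thesis by (simp add: power2_eq_iff_nonneg)
qed

text \<open>
  If rotations of \<open>a\<close> by both \<open>t\<close> and \<open>-t\<close> preserve the distance to \<open>w\<close>, then \<open>w\<close> is orthogonal
  to \<open>a\<close> and to its quarter turn.
\<close>

lemma perturb_on_circle:
  fixes a w :: "real ^ 2"
  assumes "a \<noteq> 0" "w \<noteq> 0" "\<epsilon> > 0"
  obtains b where "norm b = norm a" "norm (a - b) < \<epsilon>" "norm (b - w) \<noteq> norm (a - w)"
proof -
  \<comment> \<open>\<open>J\<close> is the quarter turn of \<open>a\<close>, and \<open>R t\<close>
    is \<open>a\<close> rotated by \<open>t\<close>.\<close>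
  define J :: "real ^ 2" where "J = vector [- vec_nth a 2, vec_nth a 1]"
  define R where "R t = cos t *\<^sub>R a + sin t *\<^sub>R J" for t
  have "(R \<longlongrightarrow> cos 0 *\<^sub>R a + sin 0 *\<^sub>R J) (at 0)"
    unfolding R_def by (intro tendsto_intros)
  then have "\<forall>\<^sub>F t in at 0. dist (R t) a < \<epsilon>" using \<open>\<epsilon> > 0\<close> by (auto dest: tendstoD)
  then obtain d where d: "d > 0" "\<And>t. t \<noteq> 0 \<Longrightarrow> dist t 0 < d \<Longrightarrow> dist (R t) a < \<epsilon>"
    unfolding eventually_at by blast
  \<comment> \<open>Less than \<open>d\<close> for closeness; at most 1, hence below pi, so that
    \<open>sin t > 0\<close> and \<open>cos t \<noteq> 1\<close>.\<close>
  define t where "t = min (d / 2) 1"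
  have t: "0 < t" "t < d" "t \<le> 1" using d(1) by (auto simp: t_def)
  have close: "norm (a - R t) < \<epsilon>" "norm (a - R (-t)) < \<epsilon>"
    using d(2)[of t] d(2)[of "-t"] t by (auto simp: dist_norm norm_minus_commute)
  have "sin t > 0" using t pi_ge_two by (intro sin_gt_zero) auto
  then have "cos t \<noteq> 1" using sin_squared_eq[of t] by auto
  have dist: "R s \<bullet> w = a \<bullet> w" if "norm (R s - w) = norm (a - w)" for s
  proof -
    have "(norm (R s - w))\<^sup>2 = (norm (a - w))\<^sup>2" "(norm (R s))\<^sup>2 = (norm a)\<^sup>2"
      using that norm_rotation_eq[of s a] by (auto simp: R_def J_def)
    then show ?thesis
      unfolding power2_norm_eq_inner by (simp add: inner_diff inner_commute)
  qed
  have "norm (R t - w) \<noteq> norm (a - w) \<or> norm (R (-t) - w) \<noteq> norm (a - w)"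
  proof (rule ccontr)
    assume "\<not> ?thesis"
    then have eqs: "R t \<bullet> w = a \<bullet> w" "R (-t) \<bullet> w = a \<bullet> w" using dist by auto
    then have "cos t * (a \<bullet> w) + sin t * (J \<bullet> w) = a \<bullet> w"
      "cos t * (a \<bullet> w) - sin t * (J \<bullet> w) = a \<bullet> w"
      by (simp_all add: R_def inner_simps)
    then have "sin t * (J \<bullet> w) = 0" "cos t * (a \<bullet> w) = a \<bullet> w" by linarith+
    then have J: "J \<bullet> w = 0" and a: "a \<bullet> w = 0"
      using \<open>sin t > 0\<close> \<open>cos t \<noteq> 1\<close> by auto
    \<comment> \<open>Pythagoras in the orthogonal frame formed by \<open>a\<close> and
      \<open>J\<close>, which have equal norm.\<close>
    have "(norm a)\<^sup>2 * (norm w)\<^sup>2 = (a \<bullet> w)\<^sup>2 + (J \<bullet> w)\<^sup>2"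
      unfolding norm_vec2 by (simp add: inner_vec_def sum_2 J_def power2_eq_square algebra_simps)
    then show False using a J assms by simp
  qed
  moreover have "norm (R s) = norm a" for s
    unfolding R_def J_def by (rule norm_rotation_eq)
  ultimately show thesis using that close by blast
qed

text \<open>The difference of two first coordinates is a nonzero polynomial, as a point with value 1
  at \<open>u\<close> and 0 elsewhere shows; so it cannot vanish at a generic framework.\<close>

lemma generic_framework_distinct:
  assumes "generic_framework G p" "u \<in> pverts G" "v \<in> pverts G" "u \<noteq> v"
  shows "p u \<noteq> p v"
proof
  assume "p u = p v"
  have "rat_poly_fun (pverts G \<times> UNIV) 1 (\<lambda>x. x (u, 1 :: 2) - x (v, 1))"
    using assms by (intro rat_poly_fun_diff rat_poly_fun_var) auto
  from rat_poly_fun_eq_0_if_alg_independent[OF this assms(1)[unfolded generic_framework_def],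
      of "\<lambda>(w, k). if w = u then 1 else 0"]
  show False using \<open>p u = p v\<close> assms(4) by simp
qed

lemma (in pair_graph) parcs_sym: "(u, v) \<in> parcs G \<longleftrightarrow> (v, u) \<in> parcs G"
  using pair_sym_arcs unfolding symmetric_def by (auto dest: symD)

lemma (in pair_graph) parcs_irrefl: "(u, u) \<notin> parcs G"
  using pair_no_loops by force

definition neighbours :: "'a pair_pre_digraph \<Rightarrow> 'a \<Rightarrow> 'a set" where
  "neighbours G v = {u \<in> pverts G. (v, u) \<in> parcs G}"

text \<open>Rotating \<open>v\<close> about its only neighbour keeps all edge lengths but changes
  the distance to a third vertex. A generic \<open>p\<close> is supplied because rigidity only
  speaks about generic frameworks and says nothing unless there is one.\<close>

lemma rigid_plane_min_degree:
  assumes "pair_graph G" and "rigid_plane G" and p: "generic_framework G p"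
    and "card (pverts G) \<ge> 3" and v: "v \<in> pverts G"
  shows "card (neighbours G v) \<ge> 2"
proof (rule ccontr)
  interpret pair_graph G by fact
  let ?N = "{u \<in> pverts G. (v, u) \<in> parcs G}"
  assume "\<not> card (neighbours G v) \<ge> 2"
  then have N: "card ?N \<le> Suc 0" by (simp add: neighbours_def)
  have "v \<notin> ?N" using parcs_irrefl by simp
  \<comment> \<open>The centre of rotation: the neighbour of \<open>v\<close>, or any other vertex
    if \<open>v\<close> is isolated.\<close>
  obtain u where u: "u \<in> pverts G" "u \<noteq> v" "?N \<subseteq> {u}"
  proof (cases "?N = {}")
    case True
    have "card {v} < card (pverts G)" using assms(4) by simp
    then have "pverts G - {v} \<noteq> {}"
      by (metis Diff_eq_empty_iff card_mono finite.emptyI finite.insertI not_le)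
    then show thesis using that True by blast
  next
    case False
    then obtain u where "u \<in> ?N" by blast
    moreover have "?N \<subseteq> {u}"
      using N \<open>u \<in> ?N\<close> pair_finite_verts by (subst (asm) card_le_Suc0_iff_eq) auto
    ultimately show thesis using that[of u] \<open>v \<notin> ?N\<close> by auto
  qed
  have "card {u, v} < card (pverts G)" using assms(4) u by simp
  then obtain w where w: "w \<in> pverts G" "w \<noteq> u" "w \<noteq> v"
    by (metis card_mono finite.emptyI finite.insertI insert_iff not_le subsetI)
  obtain \<epsilon> where \<epsilon>: "\<epsilon> > 0" "\<And>q. equivalent_frameworks G p q \<Longrightarrow>
      \<forall>u\<in>pverts G. norm (p u - q u) < \<epsilon> \<Longrightarrow> congruent_frameworks G p q"
    using assms(2) p unfolding rigid_plane_def by blast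
  have "p v - p u \<noteq> 0" "p w - p u \<noteq> 0"
    using generic_framework_distinct[OF p] u v w by auto
  then obtain b where b: "norm b = norm (p v - p u)" "norm (p v - p u - b) < \<epsilon>"
    "norm (b - (p w - p u)) \<noteq> norm (p v - p u - (p w - p u))"
    using perturb_on_circle \<open>\<epsilon> > 0\<close> by metis
  define q where "q = p(v := p u + b)"
  have "norm (p x - p y) = norm (q x - q y)" if "(x, y) \<in> parcs G" for x y
  proof -
    have "x = v \<Longrightarrow> y = u" "y = v \<Longrightarrow> x = u"
      using that parcs_sym u(3) in_arcsD1 in_arcsD2 by blast+
    then show ?thesis using b(1) u(2) by (auto simp: q_def norm_minus_commute)
  qed
  then have "equivalent_frameworks G p q" by (auto simp: equivalent_frameworks_def)
  moreover have "\<forall>x\<in>pverts G. norm (p x - q x) < \<epsilon>"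
    using b(2) \<epsilon>(1) by (auto simp: q_def algebra_simps)
  ultimately have "congruent_frameworks G p q" by (rule \<epsilon>(2))
  then have "norm (p v - p w) = norm (q v - q w)" using v w by (auto simp: congruent_frameworks_def)
  then show False using b(3) w by (simp add: q_def algebra_simps)
qed

section \<open>The spectral bound\<close>

text \<open>Over the complex numbers an eigenvalue exists. Symmetry makes it real, and it is then a
  root of the real characteristic polynomial.\<close>

lemma real_symmetric_eigenvalue_exists:
  fixes A :: "real Matrix.mat"
  assumes A: "A \<in> carrier_mat n n" and "n > 0"
    and sym: "\<And>i j. i < n \<Longrightarrow> j < n \<Longrightarrow> index_mat A (i, j) = index_mat A (j, i)"
  shows "\<exists>k. eigenvalue A k"
proof -
  let ?C = "map_mat complex_of_real A"
  have C: "?C \<in> carrier_mat n n" using A by simp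
  obtain k where k: "eigenvalue ?C k"
    using spectrum_non_empty[OF C \<open>n > 0\<close>] by (auto simp: spectrum_def)
  then obtain w where w: "w \<in> carrier_vec n" "w \<noteq> 0\<^sub>v n" "?C *\<^sub>v w = k \<cdot>\<^sub>v w"
    using C by (auto simp: eigenvalue_def eigenvector_def)
  define f where "f i = vec_index w i" for i
  define a where "a i j = index_mat A (i, j)" for i j
  have ev: "(\<Sum>j<n. of_real (a i j) * f j) = k * f i" if "i < n" for i
  proof -
    have "vec_index (?C *\<^sub>v w) i = (\<Sum>j<n. of_real (a i j) * f j)"
      using that A w(1) by (simp add: scalar_prod_def a_def f_def lessThan_atLeast0)
    then show ?thesis using w that by (simp add: f_def)
  qed
  \<comment> \<open>The Hermitian form of the matrix at the eigenvector. It equals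
    \<open>k * r\<close> with \<open>r > 0\<close>, and by symmetry it is its own conjugate.\<close>
  define S where "S = (\<Sum>i<n. \<Sum>j<n. of_real (a i j) * (f j * cnj (f i)))"
  define r where "r = (\<Sum>i<n. (cmod (f i))\<^sup>2)"
  obtain i where "i < n" "f i \<noteq> 0" using w(1,2) unfolding f_def
    by (metis carrier_vecD eq_vecI index_zero_vec(1) index_zero_vec(2))
  then have "r > 0" unfolding r_def by (intro sum_pos2[of _ i]) auto
  have "S = (\<Sum>i<n. (\<Sum>j<n. of_real (a i j) * f j) * cnj (f i))"
    by (simp add: S_def sum_distrib_right mult.assoc)
  also have "\<dots> = (\<Sum>i<n. k * of_real ((cmod (f i))\<^sup>2))"
    by (rule sum.cong[OF refl], simp only: lessThan_iff ev mult.assoc complex_norm_square)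
  also have "\<dots> = k * of_real r" by (simp add: r_def sum_distrib_left)
  finally have S: "S = k * of_real r" .
  have "cnj S = (\<Sum>i<n. \<Sum>j<n. of_real (a i j) * (cnj (f j) * f i))" by (simp add: S_def)
  also have "\<dots> = (\<Sum>j<n. \<Sum>i<n. of_real (a i j) * (cnj (f j) * f i))" by (rule sum.swap)
  also have "\<dots> = S"
    unfolding S_def using sym by (intro sum.cong) (auto simp: a_def mult.commute)
  finally have "cnj k = k" using S \<open>r > 0\<close> by simp
  then obtain l where l: "k = of_real l" by (metis complex_cnj_cancel_iff Reals_cnj_iff Reals_cases)
  have "poly (map_poly complex_of_real (char_poly A)) (of_real l) = 0"
    using k unfolding eigenvalue_root_char_poly[OF C] of_real_hom.char_poly_hom[OF A] l .
  then have "poly (char_poly A) l = 0" by simp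
  then show ?thesis using eigenvalue_root_char_poly[OF A] by blast
qed

definition graph_eigenvector :: "'a pair_pre_digraph \<Rightarrow> real \<Rightarrow> ('a \<Rightarrow> real) \<Rightarrow> bool" where
  "graph_eigenvector G k f \<longleftrightarrow> (\<exists>v\<in>pverts G. f v \<noteq> 0) \<and>
     (\<forall>u\<in>pverts G. (\<Sum>v\<in>pverts G. if (u, v) \<in> parcs G then f v else 0) = k * f u)"

lemma spectrum_vertex_order:
  assumes "finite (pverts G)"
  shows "spectrum (adjacency_matrix (vertex_order G) G) = {k. \<exists>f. graph_eigenvector G k f}"
  using eigenvalue_adjacency_matrix_iff[OF vertex_order[OF assms]]
  by (auto simp: spectrum_def graph_eigenvector_def)

text \<open>The spectrum is finite and, by symmetry of the adjacency matrix, nonempty, so its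
  \<open>Max\<close> is attained and is an upper bound.\<close>

lemma
  assumes "pair_graph G" "pverts G \<noteq> {}"
  shows graph_spectral_radius_eigenvector: "\<exists>f. graph_eigenvector G (graph_spectral_radius G) f"
    and graph_eigenvector_le_spectral_radius:
      "graph_eigenvector G k f \<Longrightarrow> k \<le> graph_spectral_radius G"
proof -
  interpret pair_graph G by fact
  let ?vs = "vertex_order G" and ?A = "adjacency_matrix (vertex_order G) G"
  note vs = vertex_order[OF pair_finite_verts]
  have A: "?A \<in> carrier_mat (length ?vs) (length ?vs)" by (simp add: adjacency_matrix_def)
  have "length ?vs > 0" using vs(2) assms(2) by auto
  then obtain k where "eigenvalue ?A k"
    using real_symmetric_eigenvalue_exists[OF A] parcs_sym by (auto simp: adjacency_matrix_def)
  then have ne: "spectrum ?A \<noteq> {}" by (auto simp: spectrum_def)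
  note fin = card_finite_spectrum(1)[OF A]
  show "\<exists>f. graph_eigenvector G (graph_spectral_radius G) f"
    using Max_in[OF fin ne] unfolding graph_spectral_radius_def spectrum_vertex_order[OF pair_finite_verts]
    by simp
  show "k \<le> graph_spectral_radius G" if "graph_eigenvector G k f" for k f
    unfolding graph_spectral_radius_def
    by (rule Max_ge[OF fin]) (use that spectrum_vertex_order[OF pair_finite_verts] in auto)
qed

text \<open>
  With \<open>y = \<bar>f\<bar>\<close> we have \<open>A y \<ge> k y\<close>, hence \<open>k (k - 1) 1\<^sup>T y \<le> (k - 1) 1\<^sup>T A y \<le> 1\<^sup>T (A\<^sup>2 - A) y\<close>,
  and the right-hand side is governed by the row sums of \<open>A\<^sup>2 - A\<close>.
\<close>

lemma eigenvalue_le_row_sums: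
  fixes a :: "'v \<Rightarrow> 'v \<Rightarrow> real" and V :: "'v set"
  defines "d \<equiv> \<lambda>u. \<Sum>v\<in>V. a u v"
  assumes "finite V" and sym: "\<And>u v. a u v = a v u" and nonneg: "\<And>u v. a u v \<ge> 0"
    and rows: "\<And>u. u \<in> V \<Longrightarrow> (\<Sum>v\<in>V. a u v * d v) - d u \<le> c"
    and k: "k \<ge> 1" and ev: "\<And>u. u \<in> V \<Longrightarrow> (\<Sum>v\<in>V. a u v * f v) = k * f u"
    and nz: "\<exists>v\<in>V. f v \<noteq> 0"
  shows "k * (k - 1) \<le> c"
    and "k * (k - 1) = c \<Longrightarrow> u \<in> V \<Longrightarrow> d u > 0 \<Longrightarrow> (\<Sum>v\<in>V. a u v * \<bar>f v\<bar>) = k * \<bar>f u\<bar>"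
    and "k * (k - 1) = c \<Longrightarrow> u \<in> V \<Longrightarrow> f u \<noteq> 0 \<Longrightarrow> (\<Sum>v\<in>V. a u v * d v) - d u = c"
proof -
  define y where "y v = \<bar>f v\<bar>" for v
  define Ay where "Ay u = (\<Sum>v\<in>V. a u v * y v)" for u
  have y: "y v \<ge> 0" for v by (simp add: y_def)
  have d: "d u \<ge> 0" for u unfolding d_def using nonneg by (simp add: sum_nonneg)
  have Ay: "Ay u \<ge> k * y u" if "u \<in> V" for u
  proof -
    have "k * y u = \<bar>\<Sum>v\<in>V. a u v * f v\<bar>" using ev[OF that] k by (simp add: y_def abs_mult)
    also have "\<dots> \<le> (\<Sum>v\<in>V. \<bar>a u v * f v\<bar>)" by (rule sum_abs)
    also have "\<dots> = Ay u" using nonneg by (simp add: Ay_def y_def abs_mult)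
    finally show ?thesis .
  qed
  define Y where "Y = (\<Sum>v\<in>V. y v)"
  have "Y > 0" using nz \<open>finite V\<close> unfolding Y_def by (auto simp: y_def intro: sum_pos2)
  \<comment> \<open>\<open>T\<close> is the total of the entries of \<open>A y\<close>, and
    \<open>Q\<close> that of the entries of \<open>A\<^sup>2 y\<close>; \<open>d\<close> is
    \<open>A\<close> applied to the all-ones vector.\<close>
  define T where "T = (\<Sum>u\<in>V. d u * y u)"
  define Q where "Q = (\<Sum>u\<in>V. d u * Ay u)"
  \<comment> \<open>By symmetry, \<open>A\<close> can be moved from \<open>y\<close> to the other
    factor \<open>g\<close>.\<close>
  have swap: "(\<Sum>u\<in>V. g u * (\<Sum>v\<in>V. a u v * y v)) = (\<Sum>u\<in>V. (\<Sum>v\<in>V. a u v * g v) * y u)" for g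
  proof -
    have "(\<Sum>u\<in>V. g u * (\<Sum>v\<in>V. a u v * y v)) = (\<Sum>u\<in>V. \<Sum>v\<in>V. a u v * g u * y v)"
      by (simp add: sum_distrib_left ac_simps)
    also have "\<dots> = (\<Sum>v\<in>V. \<Sum>u\<in>V. a u v * g u * y v)" by (rule sum.swap)
    also have "\<dots> = (\<Sum>v\<in>V. (\<Sum>u\<in>V. a v u * g u) * y v)" by (simp add: sum_distrib_right sym)
    finally show ?thesis .
  qed
  have "T = (\<Sum>u\<in>V. Ay u)" using swap[of "\<lambda>_. 1"] by (simp add: T_def Ay_def d_def)
  also have "\<dots> \<ge> (\<Sum>u\<in>V. k * y u)" using Ay by (rule sum_mono)
  finally have T: "T \<ge> k * Y" by (simp add: Y_def sum_distrib_left)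
  have "Q \<ge> (\<Sum>u\<in>V. d u * (k * y u))"
    unfolding Q_def using Ay d by (intro sum_mono mult_left_mono)
  then have Q: "Q \<ge> k * T" by (simp add: T_def sum_distrib_left ac_simps)
  define s where "s u = (\<Sum>v\<in>V. a u v * d v) - d u" for u
  have Q': "Q - T = (\<Sum>u\<in>V. s u * y u)"
    using swap[of d] by (simp add: Q_def T_def Ay_def s_def left_diff_distrib sum_subtractf)
  also have "\<dots> \<le> (\<Sum>u\<in>V. c * y u)" using rows y by (intro sum_mono mult_right_mono) (auto simp: s_def)
  finally have cY: "Q - T \<le> c * Y" by (simp add: Y_def sum_distrib_left)
  have kT: "(k - 1) * (k * Y) \<le> (k - 1) * T" using T k by (intro mult_left_mono) auto
  then have "k * (k - 1) * Y \<le> c * Y" using Q cY by (simp add: algebra_simps)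
  then show "k * (k - 1) \<le> c" using \<open>Y > 0\<close> by simp
  \<comment> \<open>Equality makes every estimate tight. Tightness of \<open>Q \<ge> k * T\<close>
    gives the eigenvalue equation for \<open>y\<close> where \<open>d\<close> is positive, and
    tightness of \<open>Q - T \<le> c * Y\<close> gives row sum \<open>c\<close> where
    \<open>f\<close> is nonzero.\<close>
  assume eq: "k * (k - 1) = c"
  then have "(k - 1) * (k * Y) = c * Y" by (simp add: algebra_simps)
  then have eqs: "Q = k * T" "Q - T = c * Y" using Q cY kT by (auto simp: algebra_simps)
  { assume u: "u \<in> V" "d u > 0"
    have "(\<Sum>u\<in>V. d u * (Ay u - k * y u)) = 0"
      using eqs(1) by (simp add: Q_def T_def right_diff_distrib sum_subtractf sum_distrib_left ac_simps)
    then have "d u * (Ay u - k * y u) = 0"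
      using u(1) \<open>finite V\<close> Ay d by (subst (asm) sum_nonneg_eq_0_iff) auto
    then show "(\<Sum>v\<in>V. a u v * \<bar>f v\<bar>) = k * \<bar>f u\<bar>" using u by (simp add: Ay_def y_def) }
  { assume u: "u \<in> V" "f u \<noteq> 0"
    have "(\<Sum>u\<in>V. (c - s u) * y u) = 0"
      using eqs(2) Q' by (simp add: Y_def left_diff_distrib sum_subtractf sum_distrib_left)
    then have "(c - s u) * y u = 0"
      using u(1) \<open>finite V\<close> rows y by (subst (asm) sum_nonneg_eq_0_iff) (auto simp: s_def)
    then show "(\<Sum>v\<in>V. a u v * d v) - d u = c" using u by (simp add: s_def y_def) }
qed

text \<open>The larger root of \<open>k * (k - 1) = 2 * (n - 2)\<close>.\<close>

definition extremal_radius :: "nat \<Rightarrow> real" where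
  "extremal_radius n = (1 + sqrt (8 * real n - 15)) / 2"

lemma
  assumes "n \<ge> 3"
  shows extremal_radius_gt_1: "extremal_radius n > 1"
    and extremal_radius_eq: "extremal_radius n * (extremal_radius n - 1) = 2 * (real n - 2)"
proof -
  have "8 * real n - 15 > 1" using assms by simp
  then have "sqrt (8 * real n - 15) > 1" by simp
  then show "extremal_radius n > 1" by (simp add: extremal_radius_def)
  have "(sqrt (8 * real n - 15))\<^sup>2 = 8 * real n - 15" using assms by simp
  then show "extremal_radius n * (extremal_radius n - 1) = 2 * (real n - 2)"
    by (simp add: extremal_radius_def power2_eq_square field_simps)
qed

text \<open>For \<open>k < 1\<close> the bound is clear, since the extremal radius exceeds 1; from 1
  on, \<open>k * (k - 1)\<close> is strictly increasing.\<close>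

lemma le_extremal_radius:
  assumes "n \<ge> 3" "k \<ge> 1 \<Longrightarrow> k * (k - 1) \<le> 2 * (real n - 2)"
  shows "k \<le> extremal_radius n"
proof (rule ccontr)
  let ?r = "extremal_radius n"
  assume "\<not> k \<le> ?r"
  then have k: "?r < k" "1 < k" using extremal_radius_gt_1[OF assms(1)] by auto
  have "?r * (?r - 1) < k * (k - 1)"
    using k extremal_radius_gt_1[OF assms(1)] by (intro mult_strict_mono) auto
  then show False using assms k extremal_radius_eq[OF assms(1)] by simp
qed

text \<open>Induction along a path. Connectedness refers to the symmetric closure, which adds no
  arcs to a graph that is already symmetric.\<close>

lemma connected_closed_set:
  assumes "pair_graph G" "Digraph_Component.connected (with_proj G)"
    and "u \<in> pverts G" "u \<in> S" and closed: "\<And>x y. (x, y) \<in> parcs G \<Longrightarrow> x \<in> S \<Longrightarrow> y \<in> S"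
  shows "pverts G \<subseteq> S"
proof
  interpret pair_graph G by fact
  fix v assume "v \<in> pverts G"
  then have "(u, v) \<in> rtrancl_on (pverts G) (parcs (mk_symmetric (with_proj G)))"
    using assms(2,3)
    by (simp add: Digraph_Component.connected_def strongly_connected_def reachable_def)
  then show "v \<in> S"
  proof (induction rule: rtrancl_on_induct)
    case base
    show ?case by fact
  next
    case (step y z)
    then have "(y, z) \<in> parcs G" using parcs_sym by (auto simp: parcs_mk_symmetric)
    then show ?case using closed step by blast
  qed
qed

section \<open>Degree counts and the bound for graphs\<close>

context pair_graph
begin

lemma finite_neighbours: "finite (neighbours G v)"
  using pair_finite_verts by (simp add: neighbours_def)

lemma neighbours_subset: "neighbours G v \<subseteq> pverts G - {v}"
  using parcs_irrefl by (auto simp: neighbours_def)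

lemma card_parcs: "card (parcs G) = (\<Sum>v\<in>pverts G. card (neighbours G v))"
proof -
  have "parcs G = Sigma (pverts G) (neighbours G)"
    using in_arcsD1 in_arcsD2 by (auto simp: neighbours_def)
  then show ?thesis using pair_finite_verts finite_neighbours by (simp add: card_SigmaI)
qed

lemma sum_neighbours:
  "(\<Sum>v\<in>pverts G. if (u, v) \<in> parcs G then g v else 0) = (\<Sum>v\<in>neighbours G u. g v)"
  unfolding neighbours_def using pair_finite_verts by (simp add: sum.inter_filter)

text \<open>The row sum of \<open>A\<^sup>2 - A\<close> at \<open>u\<close>.\<close>

lemma sum_neighbour_degrees:
  assumes u: "u \<in> pverts G"
  shows "(\<Sum>v\<in>neighbours G u. real (card (neighbours G v))) - real (card (neighbours G u)) =
    real (card (parcs G)) - 2 * (real (card (pverts G)) - 1) -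
    (\<Sum>v\<in>pverts G - neighbours G u - {u}. real (card (neighbours G v)) - 2)"
proof -
  let ?d = "\<lambda>v. real (card (neighbours G v))" and ?R = "pverts G - neighbours G u - {u}"
  have u': "u \<in> pverts G - neighbours G u" using u neighbours_subset by auto
  have N: "neighbours G u \<subseteq> pverts G" using neighbours_subset by auto
  have "real (card (parcs G)) = (\<Sum>v\<in>pverts G. ?d v)" by (simp add: card_parcs)
  also have "\<dots> = (\<Sum>v\<in>pverts G - neighbours G u. ?d v) + (\<Sum>v\<in>neighbours G u. ?d v)"
    by (rule sum.subset_diff[OF N pair_finite_verts])
  also have "(\<Sum>v\<in>pverts G - neighbours G u. ?d v) = ?d u + (\<Sum>v\<in>?R. ?d v)"
    using u' pair_finite_verts by (intro sum.remove) auto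
  \<comment> \<open>Comparing each degree with 2 brings in \<open>2 * card ?R\<close>, whose
    dependence on the degree of \<open>u\<close> cancels in the final identity.\<close>
  also have "(\<Sum>v\<in>?R. ?d v) = (\<Sum>v\<in>?R. ?d v - 2) + 2 * real (card ?R)"
    by (simp add: sum_subtractf)
  also have "real (card ?R) = real (card (pverts G)) - ?d u - 1"
  proof -
    have "card (pverts G) = card (pverts G - neighbours G u) + card (neighbours G u)"
      using N pair_finite_verts by (metis card_Diff_subset card_mono finite_neighbours le_add_diff_inverse2)
    moreover have "card (pverts G - neighbours G u) = Suc (card ?R)"
      using u' pair_finite_verts by (metis card.remove finite_Diff)
    ultimately show ?thesis by simp
  qed
  finally show ?thesis by (simp add: algebra_simps)
qed

end

text \<open>With at most \<open>4 * n - 6\<close> arcs the row sums of \<open>A\<^sup>2 - A\<close>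
  are at most \<open>(4 * n - 6) - 2 * (n - 1) = 2 * (n - 2)\<close>, the constant in the equation
  for \<open>extremal_radius\<close>.\<close>

lemma
  assumes "pair_graph G" and n: "card (pverts G) = n" "n \<ge> 3"
    and m: "card (parcs G) \<le> 2 * (2 * n - 3)"
    and deg: "\<And>v. v \<in> pverts G \<Longrightarrow> card (neighbours G v) \<ge> 2"
    and ev: "graph_eigenvector G k f"
  shows eigenvalue_le_extremal_radius: "k \<le> extremal_radius n"
    and eigenvalue_eq_extremal_radius:
      "k = extremal_radius n \<Longrightarrow> Digraph_Component.connected (with_proj G) \<Longrightarrow>
       card (parcs G) = 2 * (2 * n - 3) \<and>
       (\<forall>v\<in>pverts G. card (neighbours G v) = 2 \<or> neighbours G v = pverts G - {v})"
proof -
  interpret pair_graph G by fact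
  let ?d = "\<lambda>v. real (card (neighbours G v))"
  define a where "a u v = (if (u, v) \<in> parcs G then 1 else 0 :: real)" for u v
  have a: "(\<Sum>v\<in>pverts G. a u v * g v) = (\<Sum>v\<in>neighbours G u. g v)" for u g
    unfolding sum_neighbours[symmetric] a_def by (intro sum.cong) auto
  have d: "(\<Sum>v\<in>pverts G. a u v) = ?d u" for u using a[of u "\<lambda>_. 1"] by simp
  have a_sym: "a u v = a v u" for u v using parcs_sym by (simp add: a_def)
  have a_nonneg: "a u v \<ge> 0" for u v by (simp add: a_def)
  define X where "X u = (\<Sum>v\<in>pverts G - neighbours G u - {u}. ?d v - 2)" for u
  have X: "X u \<ge> 0" for u unfolding X_def using deg by (force intro: sum_nonneg)
  have row: "(\<Sum>v\<in>pverts G. a u v * (\<Sum>w\<in>pverts G. a v w)) - (\<Sum>v\<in>pverts G. a u v) =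
      real (card (parcs G)) - 2 * (real n - 1) - X u" if "u \<in> pverts G" for u
    using sum_neighbour_degrees[OF that] n by (simp add: a d X_def)
  have m': "real (card (parcs G)) \<le> 4 * real n - 6"
    using m n by linarith
  have rows: "(\<Sum>v\<in>pverts G. a u v * (\<Sum>w\<in>pverts G. a v w)) - (\<Sum>v\<in>pverts G. a u v) \<le> 2 * (real n - 2)"
    if "u \<in> pverts G" for u
    using row[OF that] m' X[of u] by simp
  have f: "\<exists>v\<in>pverts G. f v \<noteq> 0" "\<And>u. u \<in> pverts G \<Longrightarrow> (\<Sum>v\<in>pverts G. a u v * f v) = k * f u"
    using ev unfolding graph_eigenvector_def a sum_neighbours by auto
  note bound = eigenvalue_le_row_sums[of "pverts G" a, OF pair_finite_verts a_sym a_nonneg rows _ f(2,1)]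
  show "k \<le> extremal_radius n"
    using n bound(1) by (intro le_extremal_radius) auto
  assume k: "k = extremal_radius n" and conn: "Digraph_Component.connected (with_proj G)"
  have k1: "k \<ge> 1" and kk: "k * (k - 1) = 2 * (real n - 2)"
    using extremal_radius_gt_1[of n] extremal_radius_eq[of n] n k by auto
  \<comment> \<open>Tightness of the row sums is only known where \<open>f\<close> is nonzero. The
    support of \<open>f\<close> is closed under adjacency, since \<open>\<bar>f\<bar>\<close> also
    satisfies the eigenvalue equation, so by connectedness it is everything.\<close>
  have "pverts G \<subseteq> {v. f v \<noteq> 0}"
  proof -
    obtain u where u: "u \<in> pverts G" "f u \<noteq> 0" using f by blast
    have "f y \<noteq> 0" if xy: "(x, y) \<in> parcs G" "f x \<noteq> 0" for x y
    proof -
      have x: "x \<in> neighbours G y" and y: "y \<in> pverts G"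
        using xy parcs_sym in_arcsD1 in_arcsD2 by (auto simp: neighbours_def)
      have "?d y > 0" using deg[OF y] by simp
      then have "(\<Sum>v\<in>pverts G. a y v * \<bar>f v\<bar>) = k * \<bar>f y\<bar>"
        using bound(2)[OF _ k1 _ kk y] d by simp
      moreover have "(\<Sum>v\<in>neighbours G y. \<bar>f v\<bar>) > 0"
        using x xy finite_neighbours by (intro sum_pos2[of _ x]) auto
      ultimately show ?thesis using a by auto
    qed
    then show ?thesis using connected_closed_set[OF \<open>pair_graph G\<close> conn u(1), of "{v. f v \<noteq> 0}"] u by auto
  qed
  then have "real (card (parcs G)) - 2 * (real n - 1) - X u = 2 * (real n - 2)" if "u \<in> pverts G" for u
    using bound(3)[OF _ k1 _ kk that] row that by auto
  then have eq: "X u = 0" "real (card (parcs G)) = 4 * real n - 6" if "u \<in> pverts G" for u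
    using that X[of u] m' by (force, force)
  obtain u0 where "u0 \<in> pverts G" using f by blast
  then have "card (parcs G) = 2 * (2 * n - 3)" using eq(2) n by fastforce
  \<comment> \<open>A vertex that is not dominating has a non-neighbour \<open>u\<close>, so its
    excess degree is a nonnegative term of \<open>X u = 0\<close>.\<close>
  moreover have "card (neighbours G v) = 2" if v: "v \<in> pverts G" "neighbours G v \<noteq> pverts G - {v}" for v
  proof -
    obtain u where u: "u \<in> pverts G" "u \<noteq> v" "(v, u) \<notin> parcs G"
      using v neighbours_subset[of v] by (auto simp: neighbours_def)
    then have "v \<in> pverts G - neighbours G u - {u}" using v parcs_sym by (auto simp: neighbours_def)
    moreover have "\<forall>v\<in>pverts G - neighbours G u - {u}. ?d v - 2 = 0"
      using eq(1)[OF u(1)] deg pair_finite_verts unfolding X_def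
      by (subst (asm) sum_nonneg_eq_0_iff) force+
    ultimately show ?thesis by auto
  qed
  ultimately show "card (parcs G) = 2 * (2 * n - 3) \<and>
      (\<forall>v\<in>pverts G. card (neighbours G v) = 2 \<or> neighbours G v = pverts G - {v})" by blast
qed

text \<open>This characterises \<open>K\<^sub>2 \<nabla> (n - 2)K\<^sub>1\<close> with \<open>a\<close>, \<open>b\<close> the vertices of \<open>K\<^sub>2\<close>.\<close>

definition two_dominating :: "'a pair_pre_digraph \<Rightarrow> 'a \<Rightarrow> 'a \<Rightarrow> bool" where
  "two_dominating G a b \<longleftrightarrow> a \<in> pverts G \<and> b \<in> pverts G \<and> a \<noteq> b \<and>
     parcs G = {(x, y). x \<in> pverts G \<and> y \<in> pverts G \<and> x \<noteq> y \<and> (x \<in> {a, b} \<or> y \<in> {a, b})}"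

section \<open>The extremal graph: recognition, radius, isomorphism\<close>

text \<open>With at most one dominating vertex the degree sum is at most \<open>3 * n - 3\<close>,
  too small for \<open>n > 3\<close>. With two of them, the sum leaves exactly degree 2 for each
  other vertex.\<close>

lemma two_dominatingI:
  assumes "pair_graph G" and n: "card (pverts G) = n" "n \<ge> 3"
    and m: "card (parcs G) = 2 * (2 * n - 3)"
    and deg: "\<And>v. v \<in> pverts G \<Longrightarrow> card (neighbours G v) \<ge> 2"
    and deg': "\<And>v. v \<in> pverts G \<Longrightarrow> card (neighbours G v) = 2 \<or> neighbours G v = pverts G - {v}"
  shows "\<exists>a b. two_dominating G a b"
proof -
  interpret pair_graph G by fact
  let ?V = "pverts G" and ?d = "\<lambda>v. card (neighbours G v)"
  have cardV: "card (?V - {v}) = n - 1" if "v \<in> ?V" for v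
    using that n pair_finite_verts by simp
  define T where "T = {v \<in> ?V. neighbours G v = ?V - {v}}"
  have "finite T" using pair_finite_verts by (simp add: T_def)
  have sum: "(\<Sum>v\<in>?V. ?d v) = 4 * n - 6" using m by (simp add: card_parcs)
  have "\<not> card T \<le> Suc 0"
  proof
    assume T: "card T \<le> Suc 0"
    have "T \<subseteq> ?V" by (auto simp: T_def)
    have "(\<Sum>v\<in>?V. ?d v) = (\<Sum>v\<in>?V - T. ?d v) + (\<Sum>v\<in>T. ?d v)"
      by (rule sum.subset_diff[OF \<open>T \<subseteq> ?V\<close> pair_finite_verts])
    also have "(\<Sum>v\<in>?V - T. ?d v) = (\<Sum>v\<in>?V - T. 2)"
      using deg' by (intro sum.cong) (auto simp: T_def)
    also have "(\<Sum>v\<in>T. ?d v) = (\<Sum>v\<in>T. n - 1)"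
      using cardV by (intro sum.cong) (auto simp: T_def)
    finally have "4 * n - 6 = 2 * (n - card T) + card T * (n - 1)"
      using sum n \<open>T \<subseteq> ?V\<close> \<open>finite T\<close> by (simp add: card_Diff_subset)
    moreover have "card T = 0 \<or> card T = 1" using T by linarith
    \<comment> \<open>Both cases leave only \<open>n = 3\<close>, where degree 2 already means
      dominating, so all three vertices lie in \<open>T\<close>.\<close>
    ultimately have n3: "n = 3" using n by auto
    have "v \<in> T" if "v \<in> ?V" for v
    proof -
      have "neighbours G v = ?V - {v}"
        using neighbours_subset[of v] deg[OF that] cardV[OF that] n3 pair_finite_verts
        by (intro card_seteq) auto
      then show ?thesis using that by (simp add: T_def)
    qed
    then have "card ?V \<le> card T" using \<open>finite T\<close> by (intro card_mono) auto
    then show False using T n by simp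
  qed
  then obtain a b where ab: "a \<in> T" "b \<in> T" "a \<noteq> b"
    using \<open>finite T\<close> by (metis card_le_Suc0_iff_eq)
  then have V: "a \<in> ?V" "b \<in> ?V" and Na: "neighbours G a = ?V - {a}" and Nb: "neighbours G b = ?V - {b}"
    by (auto simp: T_def)
  have "(\<Sum>v\<in>?V. ?d v) = (\<Sum>v\<in>?V - {a, b}. ?d v) + (\<Sum>v\<in>{a, b}. ?d v)"
    using V pair_finite_verts by (intro sum.subset_diff) auto
  then have "4 * n - 6 = (\<Sum>v\<in>?V - {a, b}. ?d v) + 2 * (n - 1)"
    using sum ab cardV V by (simp add: Na Nb)
  moreover have "(\<Sum>v\<in>?V - {a, b}. ?d v) = (\<Sum>v\<in>?V - {a, b}. ?d v - 2) + (\<Sum>v\<in>?V - {a, b}. 2)"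
    unfolding sum.distrib[symmetric] by (intro sum.cong) (auto dest: deg)
  moreover have "card (?V - {a, b}) = n - 2"
    using ab V n pair_finite_verts by (simp add: card_Diff_subset)
  ultimately have "(\<Sum>v\<in>?V - {a, b}. ?d v - 2) = 0"
    using n by (simp del: sum_eq_0_iff)
  then have d2: "?d v = 2" if "v \<in> ?V - {a, b}" for v
    using that deg[of v] pair_finite_verts by (auto dest!: bspec[of _ _ v] simp: sum_eq_0_iff)
  have N: "neighbours G v = {a, b}" if v: "v \<in> ?V - {a, b}" for v
  proof -
    have "v \<in> neighbours G a" "v \<in> neighbours G b" using v Na Nb by auto
    then have "{a, b} \<subseteq> neighbours G v" using V parcs_sym by (auto simp: neighbours_def)
    then show ?thesis using d2[OF v] ab finite_neighbours by (metis card_2_iff card_subset_eq)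
  qed
  have "(x, y) \<in> parcs G \<longleftrightarrow> x \<in> ?V \<and> y \<in> ?V \<and> x \<noteq> y \<and> (x \<in> {a, b} \<or> y \<in> {a, b})" for x y
  proof -
    have *: "(x, y) \<in> parcs G \<longleftrightarrow> x \<in> ?V \<and> y \<in> neighbours G x"
      using in_arcsD1 in_arcsD2 by (auto simp: neighbours_def)
    consider "x = a" | "x = b" | "x \<in> ?V - {a, b}" | "x \<notin> ?V" by auto
    then show ?thesis unfolding * by cases (use Na Nb N V ab in auto)
  qed
  then have "two_dominating G a b" using V ab by (auto simp: two_dominating_def)
  then show ?thesis by blast
qed

text \<open>The upper bound is the general one, since these graphs satisfy its degree and edge
  conditions; an explicit eigenvector gives the lower bound.\<close>

lemma two_dominating_spectral_radius:
  assumes "pair_graph G" and n: "card (pverts G) = n" "n \<ge> 3" and G: "two_dominating G a b"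
  shows "graph_spectral_radius G = extremal_radius n"
proof (rule antisym)
  interpret pair_graph G by fact
  let ?V = "pverts G"
  have ab: "a \<in> ?V" "b \<in> ?V" "a \<noteq> b" using G by (auto simp: two_dominating_def)
  then have ne: "?V \<noteq> {}" by auto
  have Na: "neighbours G a = insert b (?V - {a, b})" and Nb: "neighbours G b = insert a (?V - {a, b})"
    and N: "\<And>v. v \<in> ?V - {a, b} \<Longrightarrow> neighbours G v = {a, b}"
    using G by (auto simp: two_dominating_def neighbours_def)
  have card_rest: "card (?V - {a, b}) = n - 2"
    using ab n pair_finite_verts by (simp add: card_Diff_subset)
  then have dab: "card (neighbours G a) = n - 1" "card (neighbours G b) = n - 1"
    using pair_finite_verts n by (auto simp: Na Nb)
  have d2: "card (neighbours G v) = 2" if "v \<in> ?V - {a, b}" for v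
    using N[OF that] ab by simp
  have deg: "card (neighbours G v) \<ge> 2" if "v \<in> ?V" for v
    using that dab d2[of v] n by (cases "v \<in> {a, b}") auto
  have "(\<Sum>v\<in>?V. card (neighbours G v)) =
      (\<Sum>v\<in>?V - {a, b}. card (neighbours G v)) + (\<Sum>v\<in>{a, b}. card (neighbours G v))"
    using ab pair_finite_verts by (intro sum.subset_diff) auto
  also have "\<dots> = 2 * (n - 2) + 2 * (n - 1)" using d2 dab ab card_rest by simp
  finally have m: "card (parcs G) \<le> 2 * (2 * n - 3)" using n by (simp add: card_parcs)
  obtain f where "graph_eigenvector G (graph_spectral_radius G) f"
    using graph_spectral_radius_eigenvector[OF \<open>pair_graph G\<close> ne] by blast
  then show "graph_spectral_radius G \<le> extremal_radius n"
    using eigenvalue_le_extremal_radius[OF \<open>pair_graph G\<close> n m deg] by blast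
  define r where "r = extremal_radius n"
  have r: "r > 1" "r * r = r + 2 * (real n - 2)"
    using extremal_radius_gt_1[OF n(2)] extremal_radius_eq[OF n(2)] by (auto simp: r_def algebra_simps)
  \<comment> \<open>At a vertex outside \<open>{a, b}\<close> the equation reads
    \<open>2 * r = r * 2\<close>; at \<open>a\<close> or \<open>b\<close> it reads
    \<open>r + 2 * (n - 2) = r * r\<close>, the equation defining \<open>r\<close>.\<close>
  define f where "f v = (if v \<in> {a, b} then r else 2)" for v
  have rest: "(\<Sum>v\<in>?V - {a, b}. f v) = 2 * (real n - 2)"
    using card_rest n by (simp add: f_def)
  have "graph_eigenvector G r f"
    unfolding graph_eigenvector_def sum_neighbours
  proof (intro conjI ballI)
    show "\<exists>v\<in>?V. f v \<noteq> 0" using ab r by (auto simp: f_def)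
    fix u assume "u \<in> ?V"
    then consider "u = a" | "u = b" | "u \<in> ?V - {a, b}" by auto
    then show "(\<Sum>v\<in>neighbours G u. f v) = r * f u"
    proof cases
      case 1
      then show ?thesis using pair_finite_verts rest r(2) by (simp add: Na f_def)
    next
      case 2
      then show ?thesis using pair_finite_verts rest r(2) by (simp add: Nb f_def)
    next
      case 3
      then show ?thesis using ab by (simp add: N f_def)
    qed
  qed
  then show "extremal_radius n \<le> graph_spectral_radius G"
    using graph_eigenvector_le_spectral_radius[OF \<open>pair_graph G\<close> ne] by (simp add: r_def)
qed

lemma two_dominating_K2_join_isolated: "two_dominating (K2_join_isolated n) (Inl 0) (Inl 1)"
  by (auto simp: two_dominating_def K2_join_isolated_def graph_join_def complete_graph_def
    edgeless_graph_def map_prod_def image_def less_2_cases_iff)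

lemma card_pverts_K2_join_isolated: "n \<ge> 2 \<Longrightarrow> card (pverts (K2_join_isolated n)) = n"
  by (simp add: K2_join_isolated_def graph_join_def complete_graph_def edgeless_graph_def
    Plus_def[symmetric] card_Plus)

text \<open>Adjacency of distinct vertices depends only on membership in the dominating pair, so any
  bijection that carries \<open>{a, b}\<close> to \<open>{c, d}\<close> is an isomorphism.\<close>

lemma two_dominating_iso:
  assumes "pair_graph G" "two_dominating G a b" and H: "pair_graph H" "two_dominating H c d"
    and card: "card (pverts G) = card (pverts H)"
  shows "digraph_iso (with_proj G) (with_proj H)"
proof -
  interpret G: pair_graph G by fact
  interpret H: pair_graph H by fact
  have ab: "a \<in> pverts G" "b \<in> pverts G" "a \<noteq> b"
    and arcs_G: "parcs G = {(x, y). x \<in> pverts G \<and> y \<in> pverts G \<and> x \<noteq> y \<and> (x \<in> {a, b} \<or> y \<in> {a, b})}"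
    using assms(2) by (auto simp: two_dominating_def)
  have cd: "c \<in> pverts H" "d \<in> pverts H" "c \<noteq> d"
    and arcs_H: "parcs H = {(x, y). x \<in> pverts H \<and> y \<in> pverts H \<and> x \<noteq> y \<and> (x \<in> {c, d} \<or> y \<in> {c, d})}"
    using H(2) by (auto simp: two_dominating_def)
  have "card (pverts G - {a, b}) = card (pverts H - {c, d})"
    using ab cd card G.pair_finite_verts H.pair_finite_verts by (simp add: card_Diff_subset)
  then obtain g where g: "bij_betw g (pverts G - {a, b}) (pverts H - {c, d})"
    using finite_same_card_bij G.pair_finite_verts H.pair_finite_verts by (metis finite_Diff)
  define h where "h = g(a := c, b := d)"
  have "bij_betw h (pverts G - {a, b}) (pverts H - {c, d})"
    using g by (subst bij_betw_cong[of _ h g]) (auto simp: h_def)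
  moreover have "bij_betw h {a, b} {c, d}" using ab cd by (auto simp: h_def bij_betw_def)
  ultimately have "bij_betw h ((pverts G - {a, b}) \<union> {a, b}) ((pverts H - {c, d}) \<union> {c, d})"
    by (rule bij_betw_combine) auto
  moreover have "(pverts G - {a, b}) \<union> {a, b} = pverts G" "(pverts H - {c, d}) \<union> {c, d} = pverts H"
    using ab cd by auto
  ultimately have h: "bij_betw h (pverts G) (pverts H)" by simp
  then have inj: "inj_on h (pverts G)" and img: "h ` pverts G = pverts H" by (auto simp: bij_betw_def)
  have hab: "h x \<in> {c, d} \<longleftrightarrow> x \<in> {a, b}" if "x \<in> pverts G" for x
    using inj_on_eq_iff[OF inj that ab(1)] inj_on_eq_iff[OF inj that ab(2)] ab by (auto simp: h_def)
  have arc: "(h x, h y) \<in> parcs H \<longleftrightarrow> (x, y) \<in> parcs G" if "x \<in> pverts G" "y \<in> pverts G" for x y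
    using that hab[of x] hab[of y] inj_on_eq_iff[OF inj that] img by (auto simp: arcs_G arcs_H)
  have arcs: "map_prod h h ` parcs G = parcs H"
  proof (intro equalityI subsetI)
    fix e assume "e \<in> map_prod h h ` parcs G"
    then show "e \<in> parcs H" using arc G.in_arcsD1 G.in_arcsD2 by fastforce
  next
    fix e assume e: "e \<in> parcs H"
    obtain x y where xy: "e = (x, y)" by (cases e)
    then have "x \<in> h ` pverts G" "y \<in> h ` pverts G"
      using e H.in_arcsD1 H.in_arcsD2 img by auto
    then obtain x' y' where "x' \<in> pverts G" "y' \<in> pverts G" "x = h x'" "y = h y'" by blast
    then show "e \<in> map_prod h h ` parcs G" using arc e xy by force
  qed
  have "inj_on (map_prod h h) (parcs G)"
    using map_prod_inj_on[OF inj inj] by (rule inj_on_subset) (auto dest: G.in_arcsD1 G.in_arcsD2)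
  then have "pre_digraph.digraph_isomorphism (with_proj G)
      \<lparr>iso_verts = h, iso_arcs = map_prod h h, iso_head = snd, iso_tail = fst\<rparr>"
    using inj G.wf_digraph by (auto simp: pre_digraph.digraph_isomorphism_def)
  moreover have "with_proj H =
      app_iso \<lparr>iso_verts = h, iso_arcs = map_prod h h, iso_head = snd, iso_tail = fst\<rparr> (with_proj G)"
    using img arcs by (simp add: app_iso_def with_proj_def)
  ultimately show ?thesis unfolding digraph_iso_def by blast
qed

lemma iso_two_dominating:
  assumes "pair_graph G" and H: "two_dominating H c d" and iso: "digraph_iso (with_proj G) (with_proj H)"
  shows "card (pverts G) = card (pverts H)" and "\<exists>a b. two_dominating G a b"
proof -
  interpret pair_graph G by fact
  obtain hom where hom: "pre_digraph.digraph_isomorphism (with_proj G) hom"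
    and app: "with_proj H = app_iso hom (with_proj G)"
    using iso unfolding digraph_iso_def by blast
  define h where "h = iso_verts hom"
  have inj: "inj_on h (pverts G)"
    using hom by (simp add: pre_digraph.digraph_isomorphism_def h_def)
  have img: "pverts H = h ` pverts G" using app by (simp add: app_iso_def with_proj_def h_def)
  have parcs: "parcs H = iso_arcs hom ` parcs G" and tail: "iso_tail hom = fst" and head: "iso_head hom = snd"
    using app by (simp_all add: app_iso_def with_proj_def)
  \<comment> \<open>An isomorphism carries a separate map on arcs. As the arcs of both graphs are
    pairs with the projections as ends, the vertex map determines it.\<close>
  have "iso_arcs hom e = map_prod h h e" if "e \<in> parcs G" for e
    using hom that by (cases e) (auto simp: pre_digraph.digraph_isomorphism_def h_def tail head prod_eq_iff)
  then have parcs: "parcs H = map_prod h h ` parcs G" unfolding parcs by (intro image_cong) auto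
  show "card (pverts G) = card (pverts H)" using inj img by (simp add: card_image)
  have arc: "(h x, h y) \<in> parcs H \<longleftrightarrow> (x, y) \<in> parcs G" if "x \<in> pverts G" "y \<in> pverts G" for x y
  proof
    assume "(h x, h y) \<in> parcs H"
    then obtain x' y' where "(x', y') \<in> parcs G" "h x = h x'" "h y = h y'" by (auto simp: parcs)
    then show "(x, y) \<in> parcs G" using inj that in_arcsD1 in_arcsD2 by (metis inj_on_eq_iff)
  qed (force simp: parcs)
  obtain a b where ab: "a \<in> pverts G" "b \<in> pverts G" "c = h a" "d = h b"
    using H img by (auto simp: two_dominating_def)
  have "(x, y) \<in> parcs G \<longleftrightarrow> x \<in> pverts G \<and> y \<in> pverts G \<and> x \<noteq> y \<and> (x \<in> {a, b} \<or> y \<in> {a, b})" for x y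
  proof (cases "x \<in> pverts G \<and> y \<in> pverts G")
    case True
    then have "(x, y) \<in> parcs G \<longleftrightarrow> h x \<noteq> h y \<and> (h x \<in> {h a, h b} \<or> h y \<in> {h a, h b})"
      using H img by (subst arc[symmetric]) (auto simp: two_dominating_def ab)
    then show ?thesis using True ab inj by (simp add: inj_on_eq_iff)
  qed (use in_arcsD1 in_arcsD2 in blast)
  then have "two_dominating G a b" using ab H by (auto simp: two_dominating_def)
  then show "\<exists>a b. two_dominating G a b" by blast
qed

section \<open>Combining the rigidity and spectral bounds\<close>

text \<open>Minimality provides the generic framework: connectedness gives an edge, and the failure
  of rigidity after its deletion is witnessed by a generic framework on the same vertices.\<close>

lemma minimally_rigid_min_degree:
  assumes "pair_graph G" "Digraph_Component.connected (with_proj G)" "minimally_rigid_plane G"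
    and "card (pverts G) \<ge> 3" and "v \<in> pverts G"
  shows "card (neighbours G v) \<ge> 2"
proof -
  interpret pair_graph G by fact
  have "parcs G \<noteq> {}"
  proof
    assume "parcs G = {}"
    then have "pverts G \<subseteq> {v}" using connected_closed_set[OF assms(1,2,5), of "{v}"] by simp
    then have "card (pverts G) \<le> card {v}" by (intro card_mono) auto
    then show False using assms(4) by simp
  qed
  then obtain x y where "(x, y) \<in> parcs G" by auto
  then have "\<not> rigid_plane (delete_edge G x y)"
    using assms(3) by (auto simp: minimally_rigid_plane_def)
  then obtain p where "generic_framework (delete_edge G x y) p"
    unfolding rigid_plane_def by blast
  then have "generic_framework G p" by (simp add: generic_framework_def delete_edge_def)
  then show ?thesis
    using assms rigid_plane_min_degree[of G p v] by (simp add: minimally_rigid_plane_def)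
qed

theorem theorem1p3:
  fixes G :: "'a pair_pre_digraph" and n :: nat
  assumes "pair_graph G"
    and "Digraph_Component.connected (with_proj G)"
    and "minimally_rigid_plane G"
    and "card (pverts G) = n"
    and "n \<ge> 3"
  shows "graph_spectral_radius G \<le> graph_spectral_radius (K2_join_isolated n) \<and>
    (graph_spectral_radius G = graph_spectral_radius (K2_join_isolated n) \<longleftrightarrow>
       digraph_iso (with_proj G) (with_proj (K2_join_isolated n)))"
proof -
  note K = pair_graph_K2_join_isolated[of n] two_dominating_K2_join_isolated[of n]
  have cardK: "card (pverts (K2_join_isolated n)) = n"
    using assms(5) by (simp add: card_pverts_K2_join_isolated)
  have rK: "graph_spectral_radius (K2_join_isolated n) = extremal_radius n"
    by (rule two_dominating_spectral_radius[OF K(1) cardK assms(5) K(2)])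
  have "pverts G \<noteq> {}" using assms(4,5) by auto
  then obtain f where f: "graph_eigenvector G (graph_spectral_radius G) f"
    using graph_spectral_radius_eigenvector[OF assms(1)] by blast
  have m: "card (parcs G) \<le> 2 * (2 * n - 3)"
    using minimally_rigid_card_parcs[OF assms(1,3)] assms(4,5) by simp
  have deg: "card (neighbours G v) \<ge> 2" if "v \<in> pverts G" for v
    using minimally_rigid_min_degree[OF assms(1-3)] assms(4,5) that by simp
  have "graph_spectral_radius G \<le> extremal_radius n"
    by (rule eigenvalue_le_extremal_radius[OF assms(1,4,5) m deg f])
  moreover have "digraph_iso (with_proj G) (with_proj (K2_join_isolated n))"
    if "graph_spectral_radius G = extremal_radius n"
  proof -
    have "\<exists>a b. two_dominating G a b"
      using eigenvalue_eq_extremal_radius[OF assms(1,4,5) m deg f that assms(2)] deg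
      by (intro two_dominatingI[OF assms(1,4,5)]) auto
    then show ?thesis using two_dominating_iso[OF assms(1) _ K] cardK assms(4) by auto
  qed
  \<comment> \<open>A graph isomorphic to the extremal one again has a dominating pair, so its
    radius is given by the same formula.\<close>
  moreover have "graph_spectral_radius G = extremal_radius n"
    if "digraph_iso (with_proj G) (with_proj (K2_join_isolated n))"
    using iso_two_dominating(2)[OF assms(1) K(2) that] two_dominating_spectral_radius[OF assms(1,4,5)]
    by blast
  ultimately show ?thesis unfolding rK by blast
qed

end
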